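(* If $1<p\leqslant\infty$, $X$ is a quasi-reflexive Banach space, and $I_X\in\mathfrak{N}_{0,p}$, then there exists a constant $C$ such that for any $k\in\mathbb{N}$ and any Lipschitz map $f:G_k\to X$, there exists an infinite subset $M$ of $\mathbb{N}$ such that for any $m_1<n_1<\ldots<m_k<n_k$ with $m_i,n_i\in M$, $$\|f(m_1,m_2,\ldots,m_k)-f(n_1,n_2,\ldots,n_k)\|\leqslant C\,\mathrm{Lip}(f)\,k^{1/p}.$$
   Context: $\mathbb{N}=\{1,2,\ldots\}$; $k^{1/\infty}=1$; $B_X$ is the closed unit ball of $X$ and $I_X$ the identity operator. A Banach space $X$ is quasi-reflexive if $\dim X^{**}/X<\infty$ ($X$ canonically embedded). $G_k$ is the set of sequences $(n_i)_{i=1}^k$ with each $n_i\in\mathbb{N}$, with the metric $d((m_i)_{i=1}^k,(n_i)_{i=1}^k)=|\{i:m_i\neq n_i\}|$; $\mathrm{Lip}(f)$ is the Lipschitz constant of $f$. The class $\mathfrak{N}_{0,p}$: let $D_X$ be the set of weakly open subsets of $X$ containing $0$, directed by reverse inclusion. For $n\in\mathbb{N}$ let $D_X^{\leqslant n}=\bigcup_{i=1}^nD_X^i$. A collection $(x_t)_{t\in D_X^{\leqslant n}}\subset X$ is weakly null if for every sequence $t$ in $D_X$ of length $<n$ (including the empty sequence) the net $(x_{t\frown(u)})_{u\in D_X}$ is weakly null ($\frown$ is concatenation). For $t\in D_X^n$ and $i\leqslant n$, $t|_i$ is the initial segment of $t$ of length $i$. For an operator (bounded linear map) $A:X\to Y$,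 define on $c_{00}$ (canonical basis $(e_i)$) $\|\sum_{i=1}^\infty a_ie_i\|_{0,A}=\sup\{\inf_{t\in D_X^n}\|A\sum_{i=1}^na_ix_{t|_i}\|:n\in\mathbb{N},(x_t)_{t\in D_X^{\leqslant n}}\subset B_X\text{ weakly null}\}$ and $\theta_{0,n}(A)=\|n^{-1}\sum_{i=1}^ne_i\|_{0,A}$. With $1/p+1/q=1$, $A\in\mathfrak{N}_{0,p}$ means $\sup_n\theta_{0,n}(A)n^{1/q}<\infty$. *)

theory Defs
  imports "HOL-Analysis.Analysis" "HOL-Library.Poly_Mapping"
begin

section \<open>Quasi-reflexive spaces\<close>

definition canonical_embedding ::
    "'a::real_normed_vector \<Rightarrow> ('a \<Rightarrow>\<^sub>L real) \<Rightarrow>\<^sub>L real" where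
  "canonical_embedding x = Blinfun (\<lambda>f. blinfun_apply f x)"

lemma canonical_embedding_apply [simp]:
  "blinfun_apply (canonical_embedding x) f = blinfun_apply f x"
proof -
  have "bounded_linear (\<lambda>f::'a \<Rightarrow>\<^sub>L real. blinfun_apply f x)"
    by (rule bounded_linear_intros)+
  then show ?thesis
    by (simp add: canonical_embedding_def bounded_linear_Blinfun_apply)
qed

lemma subspace_range_canonical_embedding: "subspace (range canonical_embedding)"
proof -
  have "linear (canonical_embedding :: 'a \<Rightarrow> _)"
    by (intro linearI)
      (auto intro!: blinfun_eqI simp: blinfun.add_right blinfun.scaleR_right
        blinfun.add_left blinfun.scaleR_left)
  then show ?thesis
    by (metis linear_subspace_image subspace_UNIV)
qed

text \<open>The quotient vector space of the bidual by the canonical copy of the space.\<close>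

quotient_type (overloaded) 'a bidual_quotient =
    "(('a::real_normed_vector \<Rightarrow>\<^sub>L real) \<Rightarrow>\<^sub>L real)" /
    "\<lambda>F G. F - G \<in> range (canonical_embedding :: 'a \<Rightarrow> _)"
proof (rule equivpI)
  let ?S = "range (canonical_embedding :: 'a \<Rightarrow> _)"
  note S = subspace_range_canonical_embedding
  show "reflp (\<lambda>F G. F - G \<in> ?S)"
    using subspace_0[OF S] by (auto intro!: reflpI simp del: image_iff)
  show "symp (\<lambda>F G. F - G \<in> ?S)"
    by (rule sympI) (metis S minus_diff_eq subspace_neg)
  show "transp (\<lambda>F G. F - G \<in> ?S)"
  proof (rule transpI)
    fix F G H assume "F - G \<in> ?S" "G - H \<in> ?S"
    then have "(F - G) + (G - H) \<in> ?S" by (rule subspace_add[OF S])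
    then show "F - H \<in> ?S" by simp
  qed
qed

instantiation bidual_quotient :: (real_normed_vector) real_vector
begin

lift_definition zero_bidual_quotient :: "'a bidual_quotient" is 0 .

lift_definition plus_bidual_quotient ::
    "'a bidual_quotient \<Rightarrow> 'a bidual_quotient \<Rightarrow> 'a bidual_quotient" is "(+)"
  using subspace_add[OF subspace_range_canonical_embedding] by (metis add_diff_add)

lift_definition minus_bidual_quotient ::
    "'a bidual_quotient \<Rightarrow> 'a bidual_quotient \<Rightarrow> 'a bidual_quotient" is "(-)"
proof -
  fix F F' G G' :: "('a \<Rightarrow>\<^sub>L real) \<Rightarrow>\<^sub>L real"
  assume "F - F' \<in> range canonical_embedding" "G - G' \<in> range canonical_embedding"
  then have "(F - F') - (G - G') \<in> range canonical_embedding"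
    by (rule subspace_diff[OF subspace_range_canonical_embedding])
  then show "(F - G) - (F' - G') \<in> range canonical_embedding"
    by (simp add: algebra_simps)
qed

lift_definition uminus_bidual_quotient ::
    "'a bidual_quotient \<Rightarrow> 'a bidual_quotient" is "uminus"
  using subspace_neg[OF subspace_range_canonical_embedding] by (metis minus_diff_minus)

lift_definition scaleR_bidual_quotient ::
    "real \<Rightarrow> 'a bidual_quotient \<Rightarrow> 'a bidual_quotient" is "scaleR"
  using subspace_scale[OF subspace_range_canonical_embedding]
  by (metis scaleR_right_diff_distrib)

instance
proof
  have refl: "F - G \<in> range (canonical_embedding :: 'a \<Rightarrow> _)" if "F = G" for F G
    using that subspace_0[OF subspace_range_canonical_embedding] by simp
  fix a b c :: "'a bidual_quotient" and r s :: real
  show "a + b + c = a + (b + c)" by transfer (rule refl, simp)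
  show "a + b = b + a" by transfer (rule refl, simp)
  show "0 + a = a" by transfer (rule refl, simp)
  show "- a + a = 0" by transfer (rule refl, simp)
  show "a - b = a + - b" by transfer (rule refl, simp)
  show "r *\<^sub>R (a + b) = r *\<^sub>R a + r *\<^sub>R b"
    by transfer (rule refl, simp add: scaleR_right_distrib)
  show "(r + s) *\<^sub>R a = r *\<^sub>R a + s *\<^sub>R a"
    by transfer (rule refl, simp add: scaleR_left_distrib)
  show "r *\<^sub>R s *\<^sub>R a = (r * s) *\<^sub>R a" by transfer (rule refl, simp)
  show "1 *\<^sub>R a = a" by transfer (rule refl, simp)
qed

end

definition quasi_reflexive :: "'a::banach itself \<Rightarrow> bool" where
  "quasi_reflexive _ \<longleftrightarrow>
     (\<exists>B :: 'a bidual_quotient set. finite B \<and> span B = UNIV)"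


section \<open>The classes $\mathfrak{N}_{0,p}$\<close>

definition weak_topology :: "'a::real_normed_vector topology" where
  "weak_topology = topology_generated_by
     {blinfun_apply f -` U | (f :: 'a \<Rightarrow>\<^sub>L real) U. open U}"

definition weak_nbhds :: "'a::real_normed_vector set set" where
  "weak_nbhds = {U. openin weak_topology U \<and> 0 \<in> U}"

text \<open>The filter of tails of the set of weakly open neighbourhoods of \<open>0\<close>, directed by
  reverse inclusion.  Limits along it are the limits of nets indexed by that directed set.\<close>

definition weak_net :: "'a::real_normed_vector set filter" where
  "weak_net = (INF u\<in>weak_nbhds. principal {v \<in> weak_nbhds. v \<subseteq> u})"

text \<open>Sequences of neighbourhoods are lists.  A collection indexed by the non-empty sequences of
  length at most \<open>n\<close> is a function on all lists, of which only the values at these lists are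
  used; \<open>t\<close> followed by \<open>u\<close> is \<^term>\<open>t @ [u]\<close>.\<close>

definition weakly_null_tree ::
    "nat \<Rightarrow> ('a::real_normed_vector set list \<Rightarrow> 'a) \<Rightarrow> bool" where
  "weakly_null_tree n x \<longleftrightarrow>
     (\<forall>t\<in>lists weak_nbhds. length t < n \<longrightarrow>
        limitin weak_topology (\<lambda>u. x (t @ [u])) 0 weak_net)"

definition unit_ball_tree ::
    "nat \<Rightarrow> ('a::real_normed_vector set list \<Rightarrow> 'a) \<Rightarrow> bool" where
  "unit_ball_tree n x \<longleftrightarrow>
     (\<forall>t\<in>lists weak_nbhds. 1 \<le> length t \<and> length t \<le> n \<longrightarrow> x t \<in> cball 0 1)"

text \<open>The space $c_{00}$ is \<^typ>\<open>nat \<Rightarrow>\<^sub>0 real\<close>, with coordinates numbered from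
  \<open>0\<close>: the basis vector $e_i$ is \<^term>\<open>Poly_Mapping.single (i - 1) (1::real)\<close>, and
  coordinate \<open>i\<close> goes with the initial segment of length \<open>i + 1\<close>.\<close>

definition tree_values ::
    "('a::real_normed_vector \<Rightarrow>\<^sub>L 'b::real_normed_vector) \<Rightarrow> (nat \<Rightarrow>\<^sub>0 real) \<Rightarrow> real set" where
  "tree_values A a =
     {INF t\<in>{t \<in> lists weak_nbhds. length t = n}.
        norm (A (\<Sum>i<n. Poly_Mapping.lookup a i *\<^sub>R x (take (Suc i) t))) | n x.
      1 \<le> n \<and> unit_ball_tree n x \<and> weakly_null_tree n x}"

definition norm0 ::
    "('a::real_normed_vector \<Rightarrow>\<^sub>L 'b::real_normed_vector) \<Rightarrow> (nat \<Rightarrow>\<^sub>0 real) \<Rightarrow> real" where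
  "norm0 A a = Sup (tree_values A a)"

text \<open>The infima and the supremum above are taken over bounded non-empty sets of reals.\<close>

lemma weak_nbhds_UNIV: "UNIV \<in> weak_nbhds"
proof -
  have "openin weak_topology (blinfun_apply (0 :: 'a \<Rightarrow>\<^sub>L real) -` UNIV)"
    unfolding weak_topology_def by (rule topology_generated_by_Basis) blast
  then show ?thesis by (simp add: weak_nbhds_def)
qed

lemma tree_values_nonempty: "tree_values A a \<noteq> {}"
proof -
  have "unit_ball_tree 1 (\<lambda>_. 0)" by (simp add: unit_ball_tree_def)
  moreover have "0 \<in> topspace weak_topology"
    using weak_nbhds_UNIV openin_subset unfolding weak_nbhds_def by blast
  then have "weakly_null_tree 1 (\<lambda>_. 0)" by (simp add: weakly_null_tree_def)
  ultimately show ?thesis unfolding tree_values_def by blast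
qed

lemma tree_values_bdd_above: "bdd_above (tree_values A a)"
proof (rule bdd_aboveI)
  fix r assume "r \<in> tree_values A a"
  then obtain n x where x: "unit_ball_tree n x" and
    r: "r = (INF t\<in>{t \<in> lists weak_nbhds. length t = n}.
           norm (A (\<Sum>i<n. Poly_Mapping.lookup a i *\<^sub>R x (take (Suc i) t))))"
    unfolding tree_values_def by blast
  define t where "t = replicate n (UNIV :: 'a set)"
  have t: "t \<in> lists weak_nbhds" "length t = n"
    using weak_nbhds_UNIV by (auto simp: t_def in_lists_conv_set)
  have "norm (x (take (Suc i) t)) \<le> 1" if "i < n" for i
  proof -
    have "take (Suc i) t \<in> lists weak_nbhds"
      using t(1) by (auto simp: in_lists_conv_set dest: in_set_takeD)
    moreover have "1 \<le> length (take (Suc i) t)" "length (take (Suc i) t) \<le> n"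
      using that t(2) by auto
    ultimately show ?thesis using x by (auto simp: unit_ball_tree_def)
  qed
  then have "norm (\<Sum>i<n. Poly_Mapping.lookup a i *\<^sub>R x (take (Suc i) t))
      \<le> (\<Sum>i<n. \<bar>Poly_Mapping.lookup a i\<bar>)"
    by (intro sum_norm_le) (auto intro: mult_left_le)
  also have "\<dots> = (\<Sum>i\<in>{..<n} \<inter> Poly_Mapping.keys a. \<bar>Poly_Mapping.lookup a i\<bar>)"
    by (rule sum.mono_neutral_right) (auto simp: in_keys_iff)
  also have "\<dots> \<le> (\<Sum>i\<in>Poly_Mapping.keys a. \<bar>Poly_Mapping.lookup a i\<bar>)"
    by (rule sum_mono2) auto
  finally have "norm (A (\<Sum>i<n. Poly_Mapping.lookup a i *\<^sub>R x (take (Suc i) t)))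
      \<le> norm A * (\<Sum>i\<in>Poly_Mapping.keys a. \<bar>Poly_Mapping.lookup a i\<bar>)"
    by (meson norm_blinfun mult_left_mono norm_ge_zero order_trans)
  moreover have "r \<le> norm (A (\<Sum>i<n. Poly_Mapping.lookup a i *\<^sub>R x (take (Suc i) t)))"
    unfolding r using t by (intro cINF_lower) (auto intro!: bdd_belowI[of _ 0])
  ultimately show "r \<le> norm A * (\<Sum>i\<in>Poly_Mapping.keys a. \<bar>Poly_Mapping.lookup a i\<bar>)" by linarith
qed

definition theta0 ::
    "nat \<Rightarrow> ('a::real_normed_vector \<Rightarrow>\<^sub>L 'b::real_normed_vector) \<Rightarrow> real" where
  "theta0 n A = norm0 A (\<Sum>i<n. Poly_Mapping.single i (1 / real n))"

text \<open>The exponents lie in $[0,\infty]$, where \<open>1 / \<infinity> = 0\<close>.\<close>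

definition class_N0 ::
    "ennreal \<Rightarrow> ('a::real_normed_vector \<Rightarrow>\<^sub>L 'b::real_normed_vector) set" where
  "class_N0 p = {A. \<exists>q::ennreal. 1 / p + 1 / q = 1 \<and>
     bdd_above ((\<lambda>n. theta0 n A * real n powr enn2real (1 / q)) ` {1..})}"


section \<open>The Hamming spaces $G_k$\<close>

definition G_carrier :: "nat \<Rightarrow> nat list set" where
  "G_carrier k = {m. length m = k \<and> set m \<subseteq> {1..}}"

definition hamming :: "nat \<Rightarrow> nat list \<Rightarrow> nat list \<Rightarrow> real" where
  "hamming k m n = real (card {i. i < k \<and> m ! i \<noteq> n ! i})"

definition G :: "nat \<Rightarrow> nat list metric" where
  "G k = metric (G_carrier k, hamming k)"

lemma Metric_space_G: "Metric_space (G_carrier k) (hamming k)"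
proof
  fix x y z :: "nat list"
  show "0 \<le> hamming k x y" by (simp add: hamming_def)
  show "hamming k x y = hamming k y x" by (simp add: hamming_def eq_commute)
  show "hamming k x y = 0 \<longleftrightarrow> x = y" if "x \<in> G_carrier k" "y \<in> G_carrier k"
    using that by (auto simp: hamming_def G_carrier_def intro: nth_equalityI)
  have "card {i. i < k \<and> x ! i \<noteq> z ! i}
      \<le> card ({i. i < k \<and> x ! i \<noteq> y ! i} \<union> {i. i < k \<and> y ! i \<noteq> z ! i})"
    by (rule card_mono) auto
  also have "\<dots> \<le> card {i. i < k \<and> x ! i \<noteq> y ! i} + card {i. i < k \<and> y ! i \<noteq> z ! i}"
    by (rule card_Un_le)
  finally show "hamming k x z \<le> hamming k x y + hamming k y z"
    unfolding hamming_def by linarith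
qed

lemma mspace_G [simp]: "mspace (G k) = G_carrier k"
  and mdist_G [simp]: "mdist (G k) = hamming k"
  by (simp_all add: G_def Metric_space.mspace_metric Metric_space.mdist_metric Metric_space_G)

definition Lip :: "'a metric \<Rightarrow> 'b metric \<Rightarrow> ('a \<Rightarrow> 'b) \<Rightarrow> real" where
  "Lip M1 M2 f = Sup {mdist M2 (f x) (f y) / mdist M1 x y | x y.
     x \<in> mspace M1 \<and> y \<in> mspace M1 \<and> x \<noteq> y}"

text \<open>$m_1 < n_1 < m_2 < n_2 < \dots < m_k < n_k$, with indices shifted to start at \<open>0\<close>.\<close>

definition interlaced :: "nat \<Rightarrow> nat list \<Rightarrow> nat list \<Rightarrow> bool" where
  "interlaced k m n \<longleftrightarrow>
     (\<forall>i<k. m ! i < n ! i) \<and> (\<forall>i. Suc i < k \<longrightarrow> n ! i < m ! Suc i)"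

end

theory Submission
  imports Defs "HOL-Library.Ramsey"
begin

text \<open>
  Normalise \<open>f\<close> to have Lipschitz constant \<open>1\<close>.  By Ramsey's theorem for the \<open>2k\<close>-element sets that
  code interlaced pairs (\<open>ramsey_interlaced\<close>) it suffices to find in every infinite set of indices a
  single interlaced pair \<open>(m, n)\<close> that satisfies the estimate (\<open>exists_interlaced_pair\<close>).

  Fix a free ultrafilter that contains the given infinite set, and let \<open>f\<^sub>j(n\<^sub>1, \<dots>, n\<^sub>j)\<close> be the
  iterated weak* limit, in the bidual, of \<open>f(n\<^sub>1, \<dots>, n\<^sub>k)\<close> over \<open>n\<^sub>k\<close>, then \<open>n\<^bsub>k-1\<^esub>\<close>, down to
  \<open>n\<^bsub>j+1\<^esub>\<close>.  The difference \<open>f(m) - f(n)\<close> is the sum over \<open>j\<close> of the differences of the increments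
  \<open>d\<^sub>j = f\<^sub>j - f\<^bsub>j-1\<^esub>\<close> at \<open>m\<close> and at \<open>n\<close>.  Each increment has norm at most \<open>1\<close> and is weak* null in its
  last variable.  Were the increments in the space itself, they would span a weakly null tree,
  and the hypothesis on \<open>theta0\<close> would bound the sum along one branch by a multiple of
  \<open>k powr (1 / p)\<close>.

  Quasi-reflexivity repairs this.  Bounded sets of the bidual are totally bounded modulo the space
  (\<open>net_modulo_span\<close>), so the class of an increment modulo the space takes, up to \<open>\<epsilon>\<close>, finitely
  many values, and along the ultrafilter it stabilises to a value that depends only on \<open>j\<close>.
  Choosing \<open>m\<close> and \<open>n\<close> accordingly, \<open>d\<^sub>j(m) - d\<^sub>j(n)\<close> is within \<open>2\<epsilon>\<close> of the space, and by Goldstine's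
  theorem (\<open>goldstine\<close>, \<open>weakly_small_approximant\<close>) within \<open>4\<epsilon>\<close> of a vector of the space that lies in
  a prescribed weak neighbourhood of \<open>0\<close>.  These vectors form a weakly null tree, to which
  \<open>weakly_null_branch\<close> applies; with \<open>4k\<epsilon> = 1\<close> the replacement costs a bounded error.  Norms in the
  space and in the bidual agree by the Hahn-Banach theorem (\<open>norm_canonical_embedding\<close>).
\<close>


section \<open>The Hahn-Banach theorem and the canonical embedding\<close>

text \<open>Subadditive and positively homogeneous; homogeneity under the factor \<open>0\<close> follows
  (\<open>sublinear_zero\<close>).\<close>

definition sublinear :: "('a::real_vector \<Rightarrow> real) \<Rightarrow> bool" where
  "sublinear s \<longleftrightarrow> (\<forall>x y. s (x + y) \<le> s x + s y) \<and> (\<forall>c x. 0 < c \<longrightarrow> s (c *\<^sub>R x) = c * s x)"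

lemma sublinear_zero:
  assumes "sublinear s" shows "s 0 = 0"
proof -
  have "s (2 *\<^sub>R 0) = 2 * s 0" using assms unfolding sublinear_def by (meson zero_less_numeral)
  then show ?thesis by simp
qed

lemma sublinear_neg:
  assumes "sublinear s" shows "- s (- y) \<le> s y"
proof -
  have "s (y + - y) \<le> s y + s (- y)" using assms unfolding sublinear_def by blast
  then show ?thesis using sublinear_zero[OF assms] by simp
qed

text \<open>A sublinear functional that is not odd at \<open>x\<close> is not minimal: the functional below lies
  under \<open>s\<close> and takes a value at most \<open>- s x\<close> at \<open>- x\<close>.\<close>

lemma sublinear_descent:
  fixes s :: "'a::real_vector \<Rightarrow> real" and x :: 'a
  assumes s: "sublinear s"
  defines "r \<equiv> \<lambda>y. INF t\<in>{0..}. s (y + t *\<^sub>R x) - t * s x"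
  shows "sublinear r" and "\<And>y. r y \<le> s y" and "r (- x) \<le> - s x"
proof -
  have add: "s (u + v) \<le> s u + s v" for u v using s unfolding sublinear_def by blast
  have hom: "s (c *\<^sub>R u) = c * s u" if "0 \<le> c" for c u
    using s that sublinear_zero[OF s] unfolding sublinear_def by (cases "c = 0") auto
  have lower: "- s (- y) \<le> s (y + t *\<^sub>R x) - t * s x" if "t \<ge> 0" for y t
    using add[of "y + t *\<^sub>R x" "- y"] hom[OF that, of x] by simp
  have bdd: "bdd_below ((\<lambda>t. s (y + t *\<^sub>R x) - t * s x) ` {0..})" for y
    by (rule bdd_belowI[of _ "- s (- y)"]) (auto intro: lower)
  have le: "r y \<le> s (y + t *\<^sub>R x) - t * s x" if "t \<ge> 0" for y t
    unfolding r_def by (rule cINF_lower[OF bdd]) (use that in auto)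
  have ge: "m \<le> r y" if "\<And>t. t \<ge> 0 \<Longrightarrow> m \<le> s (y + t *\<^sub>R x) - t * s x" for m y
    unfolding r_def by (rule cINF_greatest) (use that in auto)
  show "r y \<le> s y" for y using le[of 0 y] by simp
  show "r (- x) \<le> - s x" using le[of 1 "-x"] sublinear_zero[OF s] by simp
  have radd: "r (u + v) \<le> r u + r v" for u v
  proof -
    have *: "r (u + v) - (s (v + t' *\<^sub>R x) - t' * s x) \<le> s (u + t *\<^sub>R x) - t * s x"
      if "t \<ge> 0" "t' \<ge> 0" for t t'
    proof -
      have "r (u + v) \<le> s ((u + v) + (t + t') *\<^sub>R x) - (t + t') * s x"
        using le[of "t + t'" "u + v"] that by simp
      also have "(u + v) + (t + t') *\<^sub>R x = (u + t *\<^sub>R x) + (v + t' *\<^sub>R x)"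
        by (simp add: algebra_simps)
      finally show ?thesis using add[of "u + t *\<^sub>R x" "v + t' *\<^sub>R x"] by (simp add: algebra_simps)
    qed
    have "r (u + v) - (s (v + t' *\<^sub>R x) - t' * s x) \<le> r u" if "t' \<ge> 0" for t'
      by (rule ge) (use * that in auto)
    then have "r (u + v) - r u \<le> r v" by (intro ge) (simp add: algebra_simps)
    then show ?thesis by simp
  qed
  have rhom1: "c * r u \<le> r (c *\<^sub>R u)" if "0 < c" for c u
  proof (rule ge)
    fix t :: real assume "t \<ge> 0"
    then have "r u \<le> s (u + (t / c) *\<^sub>R x) - (t / c) * s x"
      using that \<open>t \<ge> 0\<close> by (intro le) simp
    then have "c * r u \<le> c * (s (u + (t / c) *\<^sub>R x) - (t / c) * s x)" using that by simp
    also have "\<dots> = s (c *\<^sub>R (u + (t / c) *\<^sub>R x)) - t * s x"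
      using that hom[of c] by (simp add: right_diff_distrib)
    also have "c *\<^sub>R (u + (t / c) *\<^sub>R x) = c *\<^sub>R u + t *\<^sub>R x" using that by (simp add: algebra_simps)
    finally show "c * r u \<le> s (c *\<^sub>R u + t *\<^sub>R x) - t * s x" .
  qed
  have "r (c *\<^sub>R u) = c * r u" if "0 < c" for c u
    using rhom1[OF that, of u] rhom1[of "1/c" "c *\<^sub>R u"] that by (simp add: field_simps)
  with radd show "sublinear r" unfolding sublinear_def by blast
qed

text \<open>Minimal sublinear functionals exist by Zorn's lemma, and by the previous lemma they are odd,
  hence linear.  This is the form of the Hahn-Banach theorem that is needed.\<close>

lemma linear_functional_below_sublinear:
  assumes s0: "sublinear s0"
  obtains g where "linear g" "\<And>y. g y \<le> s0 y"
proof -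
  define A where "A = {s. sublinear s \<and> s \<le> s0}"
  have "\<exists>m\<in>A. \<forall>a\<in>A. a \<le> m \<longrightarrow> a = m"
  proof (rule predicate_Zorn[where P="\<lambda>x y. y \<le> x", simplified])
    show "partial_order_on A (relation_of (\<lambda>x y. y \<le> x) A)"
      by (rule partial_order_on_relation_ofI) auto
    fix C assume C: "C \<in> Chains (relation_of (\<lambda>x y. y \<le> x) A)"
    then have CA: "C \<subseteq> A" and tot: "\<And>a b. a \<in> C \<Longrightarrow> b \<in> C \<Longrightarrow> a \<le> b \<or> b \<le> a"
      unfolding Chains_def relation_of_def by auto
    show "\<exists>u\<in>A. \<forall>a\<in>C. u \<le> a"
    proof (cases "C = {}")
      case True then show ?thesis using s0 by (auto simp: A_def)
    next
      case False
      define u where "u = (\<lambda>y. INF s\<in>C. s y)"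
      have sub: "sublinear s" "s \<le> s0" if "s \<in> C" for s using CA that by (auto simp: A_def)
      have lower: "- s0 (- y) \<le> s y" if "s \<in> C" for s y
        using sublinear_neg[OF sub(1)[OF that], of y] le_funD[OF sub(2)[OF that], of "- y"] by simp
      have bdd: "bdd_below ((\<lambda>s. s y) ` C)" for y
        by (rule bdd_belowI[of _ "- s0 (- y)"]) (auto intro: lower)
      have le: "u y \<le> s y" if "s \<in> C" for s y unfolding u_def by (rule cINF_lower[OF bdd that])
      have ge: "m \<le> u y" if "\<And>s. s \<in> C \<Longrightarrow> m \<le> s y" for m y
        unfolding u_def by (rule cINF_greatest[OF False]) (rule that)
      have "u (x + y) \<le> u x + u y" for x y
      proof -
        \<comment> \<open>The smaller of two members of the chain serves for both summands.\<close>
        have "u (x + y) - s y \<le> s' x" if ss: "s \<in> C" "s' \<in> C" for s s'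
        proof -
          obtain r where r: "r \<in> C" "r \<le> s" "r \<le> s'"
            using tot[OF ss] ss by (metis order_refl)
          have "u (x + y) \<le> r (x + y)" by (rule le[OF r(1)])
          also have "\<dots> \<le> r x + r y" using sub(1)[OF r(1)] unfolding sublinear_def by blast
          finally show ?thesis using le_funD[OF r(2), of y] le_funD[OF r(3), of x] by simp
        qed
        then have "u (x + y) - s y \<le> u x" if "s \<in> C" for s using that by (intro ge) auto
        then have "u (x + y) - u x \<le> u y" by (intro ge) (simp add: algebra_simps)
        then show ?thesis by simp
      qed
      moreover have "u (c *\<^sub>R x) = c * u x" if "0 < c" for c x
      proof (rule antisym)
        have hom: "s (c *\<^sub>R x) = c * s x" if "s \<in> C" for s
          using sub(1)[OF that] \<open>0 < c\<close> unfolding sublinear_def by blast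
        have "u (c *\<^sub>R x) / c \<le> u x"
          using le[of _ "c *\<^sub>R x"] hom that by (intro ge) (simp add: divide_le_eq mult.commute)
        then show "u (c *\<^sub>R x) \<le> c * u x" using that by (simp add: field_simps)
        show "c * u x \<le> u (c *\<^sub>R x)"
        proof (rule ge)
          fix s assume "s \<in> C"
          then show "c * u x \<le> s (c *\<^sub>R x)" using mult_left_mono[OF le[of s x], of c] hom that by simp
        qed
      qed
      ultimately have "sublinear u" unfolding sublinear_def by blast
      moreover have "u \<le> s0"
      proof (rule le_funI)
        fix y
        obtain s where "s \<in> C" using False by blast
        then show "u y \<le> s0 y" using order_trans[OF le[of s y] le_funD[OF sub(2)[of s], of y]] by simp
      qed
      moreover have "u \<le> s" if "s \<in> C" for s using le[OF that] by (rule le_funI)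
      ultimately show ?thesis unfolding A_def by blast
    qed
  qed
  then obtain g where g: "sublinear g" "g \<le> s0"
    and min: "\<And>s. sublinear s \<Longrightarrow> s \<le> s0 \<Longrightarrow> s \<le> g \<Longrightarrow> s = g" by (auto simp: A_def)
  have neg: "g (- x) = - g x" for x
  proof -
    let ?r = "\<lambda>y. INF t\<in>{0..}. g (y + t *\<^sub>R x) - t * g x"
    note d = sublinear_descent[OF g(1), where x = x]
    have "?r \<le> g" using d(2) by (rule le_funI)
    then have "?r = g" using min[OF d(1) order_trans[OF _ g(2)]] by blast
    then have "?r (- x) = g (- x)" by (rule fun_cong)
    then have "g (- x) \<le> - g x" using d(3) by simp
    then show ?thesis using sublinear_neg[OF g(1), of x] by simp
  qed
  have add: "g (x + y) = g x + g y" for x y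
  proof (rule antisym)
    show "g (x + y) \<le> g x + g y" using g(1) unfolding sublinear_def by blast
    have "g (- x + - y) \<le> g (- x) + g (- y)" using g(1) unfolding sublinear_def by blast
    then show "g x + g y \<le> g (x + y)" using neg[of "x + y"] by (simp add: neg)
  qed
  have pos: "g (c *\<^sub>R x) = c * g x" if "0 < c" for c x using g(1) that unfolding sublinear_def by blast
  have "g (c *\<^sub>R x) = c * g x" for c x
    using pos[of c x] pos[of "- c" x] neg[of "c *\<^sub>R x"] sublinear_zero[OF g(1)]
    by (cases c "0::real" rule: linorder_cases) auto
  with add have "linear g" by (intro linearI) auto
  then show ?thesis using that g(2) by (auto simp: le_fun_def)
qed

lemma norming_functional:
  fixes x :: "'a::real_normed_vector"
  obtains \<phi> :: "'a \<Rightarrow>\<^sub>L real" where "norm \<phi> \<le> 1" "\<phi> x = norm x"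
proof -
  let ?r = "\<lambda>y. INF t\<in>{0..}. norm (y + t *\<^sub>R x) - t * norm x"
  have s: "sublinear (norm :: 'a \<Rightarrow> real)" by (simp add: sublinear_def norm_triangle_ineq)
  note d = sublinear_descent[OF s, where x = x]
  \<comment> \<open>The bound of \<open>?r\<close> at \<open>- x\<close> forces \<open>g x = norm x\<close>.\<close>
  obtain g where g: "linear g" "\<And>y. g y \<le> ?r y"
    using linear_functional_below_sublinear[OF d(1)] by blast
  have le: "g y \<le> norm y" for y using order_trans[OF g(2)[of y] d(2)[of y]] .
  have abs: "\<bar>g y\<bar> \<le> norm y" for y using le[of y] le[of "- y"] linear_neg[OF g(1), of y] by auto
  have bl: "bounded_linear g"
    using g(1) abs by (intro bounded_linear_intro[of _ 1]) (auto simp: linear_add linear_scale)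
  have "g (- x) \<le> - norm x" using order_trans[OF g(2) d(3)] .
  then have "g x = norm x" using le[of x] linear_neg[OF g(1), of x] by simp
  moreover have "norm (Blinfun g) \<le> 1"
    using abs by (intro norm_blinfun_bound) (auto simp: bounded_linear_Blinfun_apply[OF bl])
  ultimately show ?thesis using that[of "Blinfun g"] by (simp add: bounded_linear_Blinfun_apply[OF bl])
qed

lemma norm_canonical_embedding [simp]: "norm (canonical_embedding x) = norm x"
proof (rule antisym)
  show "norm (canonical_embedding x) \<le> norm x"
    by (rule norm_blinfun_bound) (auto, metis norm_blinfun mult.commute real_norm_def)
  obtain \<phi> :: "'a \<Rightarrow>\<^sub>L real" where \<phi>: "norm \<phi> \<le> 1" "\<phi> x = norm x" by (rule norming_functional)
  have "norm x \<le> norm (canonical_embedding x) * norm \<phi>"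
    using norm_blinfun[of "canonical_embedding x" \<phi>] \<phi>(2) by simp
  also have "\<dots> \<le> norm (canonical_embedding x)" using \<phi>(1) by (simp add: mult_left_le)
  finally show "norm x \<le> norm (canonical_embedding x)" .
qed

lemma bounded_linear_canonical_embedding: "bounded_linear canonical_embedding"
  by (rule bounded_linear_intro[of _ 1])
    (auto intro!: blinfun_eqI simp: blinfun.add_right blinfun.scaleR_right
        blinfun.add_left blinfun.scaleR_left)

lemmas linear_canonical_embedding = bounded_linear.linear[OF bounded_linear_canonical_embedding]

lemma closed_range_canonical_embedding: "closed (range (canonical_embedding :: 'a::banach \<Rightarrow> _))"
proof -
  have "complete (canonical_embedding ` (UNIV :: 'a set))"
    by (rule complete_isometric_image[of 1])
      (auto simp: subspace_UNIV bounded_linear_canonical_embedding complete_UNIV)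
  then show ?thesis by (rule complete_imp_closed)
qed


section \<open>Limits along ultrafilters\<close>

text \<open>Ultrafilters, as proper filters that decide every predicate.\<close>

definition ultra :: "'a filter \<Rightarrow> bool" where
  "ultra U \<longleftrightarrow> U \<noteq> bot \<and> (\<forall>P. eventually P U \<or> eventually (\<lambda>x. \<not> P x) U)"

lemma ex_ultra:
  assumes "F \<noteq> bot"
  obtains U where "ultra U" "U \<le> F"
proof -
  define A where "A = {G. G \<noteq> bot \<and> G \<le> F}"
  have "\<exists>m\<in>A. \<forall>a\<in>A. a \<le> m \<longrightarrow> a = m"
  proof (rule predicate_Zorn[where P="\<lambda>x y. y \<le> x", simplified])
    show "partial_order_on A (relation_of (\<lambda>x y. y \<le> x) A)"
      by (rule partial_order_on_relation_ofI) auto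
    fix C assume C: "C \<in> Chains (relation_of (\<lambda>x y. y \<le> x) A)"
    then have CA: "C \<subseteq> A" and tot: "\<And>a b. a \<in> C \<Longrightarrow> b \<in> C \<Longrightarrow> a \<le> b \<or> b \<le> a"
      unfolding Chains_def relation_of_def by auto
    show "\<exists>u\<in>A. \<forall>a\<in>C. u \<le> a"
    proof (cases "C = {}")
      case True then show ?thesis using assms by (auto simp: A_def)
    next
      case False
      have "eventually (\<lambda>_. False) (Inf C) \<longleftrightarrow> (\<exists>b\<in>C. eventually (\<lambda>_. False) b)"
        by (rule eventually_Inf_base[OF False]) (use tot in \<open>meson le_inf_iff order_refl\<close>)
      then have "Inf C \<noteq> bot" using CA by (auto simp: A_def trivial_limit_def)
      moreover have "Inf C \<le> F" using CA False by (auto simp: A_def intro: Inf_lower2)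
      ultimately show ?thesis by (auto simp: A_def intro: Inf_lower)
    qed
  qed
  then obtain U where U: "U \<noteq> bot" "U \<le> F" and
    min: "\<And>G. G \<noteq> bot \<Longrightarrow> G \<le> F \<Longrightarrow> G \<le> U \<Longrightarrow> G = U" by (auto simp: A_def)
  have "eventually (\<lambda>x. \<not> P x) U" if "\<not> eventually P U" for P
  proof -
    have "inf U (principal {x. \<not> P x}) \<noteq> bot"
      using that by (simp add: trivial_limit_def eventually_inf_principal)
    then have "inf U (principal {x. \<not> P x}) = U" by (rule min) (use U in \<open>auto intro: le_infI1\<close>)
    then have "U \<le> principal {x. \<not> P x}" by (metis inf.cobounded2)
    then show ?thesis by (simp add: le_principal)
  qed
  then show ?thesis using that U unfolding ultra_def by blast
qed

lemma ultra_colour: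
  assumes U: "ultra U" and N: "finite N" "\<And>n. h n \<in> N"
  shows "\<exists>c. eventually (\<lambda>n. h n = c) U"
proof (rule ccontr)
  assume "\<not> ?thesis"
  then have "\<forall>c\<in>N. eventually (\<lambda>n. h n \<noteq> c) U" using U unfolding ultra_def by blast
  then have "eventually (\<lambda>n. \<forall>c\<in>N. h n \<noteq> c) U" by (simp add: eventually_ball_finite[OF N(1)])
  then have "eventually (\<lambda>_. False) U" by (rule eventually_mono) (use N in auto)
  then show False using U by (auto simp: ultra_def trivial_limit_def)
qed

lemma ultra_compact_limit:
  assumes U: "ultra U" and K: "compact K" "\<And>n. h n \<in> K"
  shows "\<exists>l\<in>K. (h \<longlongrightarrow> l) U"
proof -
  let ?F = "filtermap h U"
  have "?F \<noteq> bot" using U by (simp add: ultra_def filtermap_bot_iff)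
  moreover have "eventually (\<lambda>x. x \<in> K) ?F" using K by (simp add: eventually_filtermap)
  ultimately obtain l where l: "l \<in> K" "inf (nhds l) ?F \<noteq> bot"
    using K(1) unfolding compact_filter by blast
  have "eventually P ?F" if P: "eventually P (nhds l)" for P
  proof (rule ccontr)
    assume "\<not> eventually P ?F"
    then have "eventually (\<lambda>x. \<not> P x) ?F" using U unfolding ultra_def eventually_filtermap by blast
    with P have "eventually (\<lambda>_. False) (inf (nhds l) ?F)" unfolding eventually_inf by blast
    then show False using l(2) by (simp add: trivial_limit_def)
  qed
  then have "?F \<le> nhds l" by (simp add: filter_leI)
  then show ?thesis using l(1) by (auto simp: filterlim_def)
qed

text \<open>Convergence in the weak* topology of the dual of the type \<open>'b\<close>; below, \<open>'b\<close> is itself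
  a dual space, so that the limits are taken in a bidual.\<close>

definition wstar_tendsto :: "('b::real_normed_vector \<Rightarrow>\<^sub>L real) \<Rightarrow> 'i filter \<Rightarrow> ('i \<Rightarrow> 'b \<Rightarrow>\<^sub>L real) \<Rightarrow> bool" where
  "wstar_tendsto l U g \<longleftrightarrow> (\<forall>\<phi>. ((\<lambda>n. g n \<phi>) \<longlongrightarrow> l \<phi>) U)"

lemma ultra_wstar_limit:
  fixes g :: "'i \<Rightarrow> ('b::real_normed_vector \<Rightarrow>\<^sub>L real)"
  assumes U: "ultra U" and b: "\<And>n. norm (g n) \<le> b"
  shows "\<exists>l. wstar_tendsto l U g"
proof -
  have bd: "\<bar>g n \<phi>\<bar> \<le> b * norm \<phi>" for n \<phi>
    using norm_blinfun[of "g n" \<phi>] mult_right_mono[OF b[of n], of "norm \<phi>"] by simp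
  have "\<exists>l\<in>cball 0 (b * norm \<phi>). ((\<lambda>n. g n \<phi>) \<longlongrightarrow> l) U" for \<phi>
    by (rule ultra_compact_limit[OF U]) (use bd in auto)
  then obtain l where l: "\<And>\<phi>. l \<phi> \<in> cball 0 (b * norm \<phi>)" "\<And>\<phi>. ((\<lambda>n. g n \<phi>) \<longlongrightarrow> l \<phi>) U"
    by metis
  have nb: "U \<noteq> bot" using U by (simp add: ultra_def)
  have "bounded_linear l"
  proof (rule bounded_linear_intro)
    show "l (x + y) = l x + l y" for x y
      by (rule tendsto_unique[OF nb l(2)]) (simp add: blinfun.add_right tendsto_add l(2))
    show "l (r *\<^sub>R x) = r *\<^sub>R l x" for r x
      by (rule tendsto_unique[OF nb l(2)]) (simp add: blinfun.scaleR_right tendsto_mult_left l(2))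
    show "norm (l x) \<le> norm x * b" for x using l(1)[of x] by (simp add: mult.commute)
  qed
  then show ?thesis using l(2)
    by (intro exI[of _ "Blinfun l"]) (simp add: wstar_tendsto_def bounded_linear_Blinfun_apply)
qed

lemma wstar_tendsto_diff:
  assumes "wstar_tendsto l U g" "wstar_tendsto l' U g'"
  shows "wstar_tendsto (l - l') U (\<lambda>n. g n - g' n)"
  using assms unfolding wstar_tendsto_def by (simp add: blinfun.diff_left tendsto_diff)

lemma wstar_tendsto_norm_le:
  assumes nb: "U \<noteq> bot" and l: "wstar_tendsto l U g" and b: "\<And>n. norm (g n) \<le> b"
  shows "norm l \<le> b"
proof (rule norm_blinfun_bound)
  show "0 \<le> b" using b norm_ge_zero order_trans by blast
  fix \<phi>
  have "\<bar>g n \<phi>\<bar> \<le> b * norm \<phi>" for n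
    using norm_blinfun[of "g n" \<phi>] mult_right_mono[OF b[of n], of "norm \<phi>"] by simp
  moreover have "((\<lambda>n. \<bar>g n \<phi>\<bar>) \<longlongrightarrow> \<bar>l \<phi>\<bar>) U"
    using l by (intro tendsto_rabs) (simp add: wstar_tendsto_def)
  ultimately show "norm (l \<phi>) \<le> b * norm \<phi>"
    unfolding real_norm_def by (intro tendsto_upperbound[OF _ _ nb]) auto
qed


section \<open>Goldstine's theorem\<close>

text \<open>Goldstine's theorem for finitely many functionals.  No separation theorem is needed: if \<open>z\<close>
  nearly minimises the sum \<open>q\<close> of the squared errors over the ball of radius \<open>r\<close>, then the
  functional \<open>\<psi>\<close> weighted by the errors at \<open>z\<close> nearly attains its norm on the ball at \<open>z\<close>,
  and comparing \<open>D \<psi>\<close> with \<open>r * norm \<psi>\<close> shows that \<open>q z\<close> is small.\<close>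

lemma goldstine:
  fixes D :: "('a::real_normed_vector \<Rightarrow>\<^sub>L real) \<Rightarrow>\<^sub>L real"
  assumes D: "norm D \<le> r" and r: "0 < r" and \<Phi>: "finite (\<Phi> :: ('a \<Rightarrow>\<^sub>L real) set)" and \<delta>: "0 < \<delta>"
  obtains z where "norm z \<le> r" "\<And>\<phi>. \<phi> \<in> \<Phi> \<Longrightarrow> \<bar>\<phi> z - D \<phi>\<bar> < \<delta>"
proof -
  define q where "q z = (\<Sum>\<phi>\<in>\<Phi>. (D \<phi> - \<phi> z)\<^sup>2)" for z
  define K where "K = (\<Sum>\<phi>\<in>\<Phi>. (norm \<phi> * (2 * r))\<^sup>2)"
  have K: "K \<ge> 0" unfolding K_def by (rule sum_nonneg) simp
  \<comment> \<open>The error terms \<open>t * K\<close> and \<open>\<eta> / t\<close> of the optimality condition are below \<open>\<delta>\<^sup>2\<close>.\<close>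
  define t where "t = min 1 (\<delta>\<^sup>2 / (K + 1))"
  have t: "0 < t" "t \<le> 1" using \<delta> K by (auto simp: t_def)
  have "t \<le> \<delta>\<^sup>2 / (K + 1)" by (simp add: t_def)
  then have "t * (K + 1) \<le> \<delta>\<^sup>2" using K by (subst (asm) pos_le_divide_eq) auto
  then have tK: "t * K < \<delta>\<^sup>2" using t by (simp add: algebra_simps)
  define B where "B = (cball 0 r :: 'a set)"
  have B0: "B \<noteq> {}" using r by (simp add: B_def)
  have bdd: "bdd_below (q ` B)" by (rule bdd_belowI[of _ 0]) (auto simp: q_def sum_nonneg)
  define \<eta> where "\<eta> = t * \<delta>\<^sup>2 / 2"
  have \<eta>: "\<eta> > 0" using t \<delta> by (simp add: \<eta>_def)
  have "\<exists>z\<in>B. q z < (INF z\<in>B. q z) + \<eta>"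
    using cINF_less_iff[OF B0 bdd, of "(INF z\<in>B. q z) + \<eta>"] \<eta> by simp
  then obtain z where z0: "z \<in> B" "q z < (INF z\<in>B. q z) + \<eta>" by blast
  have z: "z \<in> B" "\<And>w. w \<in> B \<Longrightarrow> q z \<le> q w + \<eta>"
    using z0 cINF_lower[OF bdd] by (fastforce)+
  define a where "a \<phi> = D \<phi> - \<phi> z" for \<phi>
  define \<psi> where "\<psi> = (\<Sum>\<phi>\<in>\<Phi>. a \<phi> *\<^sub>R \<phi>)"
  have \<psi>: "\<psi> w = (\<Sum>\<phi>\<in>\<Phi>. a \<phi> * \<phi> w)" for w
    unfolding \<psi>_def by (simp add: blinfun.sum_left blinfun.scaleR_left)
  \<comment> \<open>First-order optimality: move from \<open>z\<close> a step \<open>t\<close> in the direction of \<open>w\<close>.\<close>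
  have ineq: "2 * (\<psi> w - \<psi> z) \<le> \<delta>\<^sup>2 / 2 + t * K" if w: "w \<in> B" for w
  proof -
    have "z + t *\<^sub>R (w - z) = (1 - t) *\<^sub>R z + t *\<^sub>R w" by (simp add: algebra_simps)
    then have "z + t *\<^sub>R (w - z) \<in> B"
      using convexD[OF convex_cball, of z 0 r w "1 - t" t] z(1) w t unfolding B_def by simp
    then have "q z \<le> q (z + t *\<^sub>R (w - z)) + \<eta>" by (rule z(2))
    also have "q (z + t *\<^sub>R (w - z)) = (\<Sum>\<phi>\<in>\<Phi>. (a \<phi>)\<^sup>2 - 2 * t * (a \<phi> * \<phi> w - a \<phi> * \<phi> z) + t\<^sup>2 * (\<phi> (w - z))\<^sup>2)"
      unfolding q_def a_def
      by (intro sum.cong refl)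
        (simp add: blinfun.add_right blinfun.scaleR_right blinfun.diff_right power2_eq_square algebra_simps)
    also have "\<dots> = q z - 2 * t * (\<psi> w - \<psi> z) + t\<^sup>2 * (\<Sum>\<phi>\<in>\<Phi>. (blinfun_apply \<phi> (w - z))\<^sup>2)"
      by (simp add: sum.distrib sum_subtractf \<psi> q_def a_def sum_distrib_left right_diff_distrib)
    also have "(\<Sum>\<phi>\<in>\<Phi>. (blinfun_apply \<phi> (w - z))\<^sup>2) \<le> K"
      unfolding K_def
    proof (rule sum_mono)
      fix \<phi> :: "'a \<Rightarrow>\<^sub>L real"
      have "norm (w - z) \<le> 2 * r" using w z(1) norm_triangle_ineq4[of w z] by (simp add: B_def)
      then have "norm (\<phi> (w - z)) \<le> norm \<phi> * (2 * r)"
        using norm_blinfun[of \<phi> "w - z"] by (meson mult_left_mono norm_ge_zero order_trans)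
      then show "(\<phi> (w - z))\<^sup>2 \<le> (norm \<phi> * (2 * r))\<^sup>2"
        using abs_le_square_iff[of "\<phi> (w - z)" "norm \<phi> * (2 * r)"] r by (simp add: abs_mult)
    qed
    finally have "q z \<le> q z - 2 * t * (\<psi> w - \<psi> z) + t\<^sup>2 * K + \<eta>" by (simp add: mult_left_mono)
    then have "t * (2 * (\<psi> w - \<psi> z)) \<le> t * (\<delta>\<^sup>2 / 2 + t * K)"
      by (simp add: \<eta>_def power2_eq_square algebra_simps)
    then show ?thesis using t by simp
  qed
  define S where "S = \<psi> z + \<delta>\<^sup>2 / 4 + t * K / 2"
  have up: "\<psi> w \<le> S" if "norm w \<le> r" for w
    using ineq[of w] that by (simp add: S_def B_def field_simps)
  have "norm \<psi> \<le> S / r"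
  proof (rule norm_blinfun_bound)
    show "0 \<le> S / r" using up[of 0] r by simp
    fix w
    show "norm (\<psi> w) \<le> S / r * norm w"
    proof (cases "w = 0")
      case False
      have "\<psi> ((r / norm w) *\<^sub>R w) \<le> S" "\<psi> ((- r / norm w) *\<^sub>R w) \<le> S"
        using r False by (auto intro!: up)
      then have "\<bar>\<psi> w\<bar> * r \<le> S * norm w"
        using r False by (simp add: blinfun.scaleR_right blinfun.minus_right field_simps abs_if)
      then show ?thesis using r by (simp add: field_simps)
    qed simp
  qed
  then have "r * norm \<psi> \<le> S" using r by (simp add: field_simps)
  moreover have "D \<psi> \<le> r * norm \<psi>"
    using norm_blinfun[of D \<psi>] mult_right_mono[OF D, of "norm \<psi>"] by simp
  ultimately have "D \<psi> \<le> S" by simp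
  moreover have "D \<psi> = (\<Sum>\<phi>\<in>\<Phi>. a \<phi> * D \<phi>)"
    unfolding \<psi>_def by (simp add: blinfun.sum_right blinfun.scaleR_right)
  moreover have "(\<Sum>\<phi>\<in>\<Phi>. a \<phi> * D \<phi>) - \<psi> z = q z"
    unfolding \<psi> sum_subtractf[symmetric] q_def a_def
    by (intro sum.cong refl) (simp add: power2_eq_square algebra_simps)
  ultimately have "q z < \<delta>\<^sup>2" using tK zero_less_power[OF \<delta>, of 2] unfolding S_def by linarith
  have "\<bar>\<phi> z - D \<phi>\<bar> < \<delta>" if "\<phi> \<in> \<Phi>" for \<phi>
  proof -
    have "(\<phi> z - D \<phi>)\<^sup>2 \<le> q z"
      unfolding q_def using member_le_sum[OF that, of "\<lambda>\<phi>. (D \<phi> - \<phi> z)\<^sup>2"] \<Phi> by (simp add: power2_commute)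
    with \<open>q z < \<delta>\<^sup>2\<close> have "(\<phi> z - D \<phi>)\<^sup>2 < \<delta>\<^sup>2" by simp
    then show ?thesis using \<delta> by (intro power2_less_imp_less[of "\<bar>\<phi> z - D \<phi>\<bar>" \<delta>]) auto
  qed
  then show ?thesis using that z(1) by (simp add: B_def)
qed


section \<open>Total boundedness of the bidual modulo the space\<close>

text \<open>Every bounded part of \<open>Z\<close> has a finite \<open>\<epsilon>\<close>-net modulo \<open>Y\<close>; for a closed subspace \<open>Y\<close> of \<open>Z\<close>
  this is total boundedness of the bounded sets of the quotient \<open>Z / Y\<close>, expressed without
  forming the quotient.\<close>

definition net_modulo :: "'v::real_normed_vector set \<Rightarrow> 'v set \<Rightarrow> bool" where
  "net_modulo Y Z \<longleftrightarrow> (\<forall>R \<epsilon>. 0 < \<epsilon> \<longrightarrow>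
     (\<exists>N. finite N \<and> (\<forall>v\<in>Z. norm v \<le> R \<longrightarrow> (\<exists>g\<in>N. \<exists>y\<in>Y. norm (v - g - y) \<le> \<epsilon>))))"

lemma net_modulo_insert:
  assumes Z: "subspace Z" "closed Z" "net_modulo Y Z"
  shows "closed (span (insert b Z)) \<and> net_modulo Y (span (insert b Z))"
proof (cases "b \<in> Z")
  case True
  then have "span (insert b Z) = Z" using Z(1) by (simp add: insert_absorb span_eq_iff)
  then show ?thesis using Z by simp
next
  case False
  have span: "v \<in> span (insert b Z) \<longleftrightarrow> (\<exists>c. v - c *\<^sub>R b \<in> Z)" for v
    using Z(1) by (simp add: span_insert span_eq_iff[THEN iffD2])
  obtain d where d: "d > 0" "ball b d \<subseteq> - Z"
    using False Z(2) open_contains_ball[of "- Z"] by (auto simp: open_Compl)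
  \<comment> \<open>The coefficient of \<open>b\<close> is a bounded functional, since \<open>b\<close> has distance at least \<open>d\<close> to \<open>Z\<close>.\<close>
  have coeff: "\<bar>c\<bar> * d \<le> norm v" if "v - c *\<^sub>R b \<in> Z" for v c
  proof (cases "c = 0")
    case False
    have eq: "b - (1 / c) *\<^sub>R v = (- 1 / c) *\<^sub>R (v - c *\<^sub>R b)"
      using False by (simp add: algebra_simps)
    have "b - (1 / c) *\<^sub>R v \<in> Z" unfolding eq using Z(1) that by (rule subspace_scale)
    then have "b - (1 / c) *\<^sub>R v \<notin> ball b d" using d(2) by blast
    then have "d \<le> norm v / \<bar>c\<bar>" by (simp add: dist_norm)
    then show ?thesis using False by (simp add: field_simps)
  qed simp
  have "closed (span (insert b Z))"
    unfolding closed_sequential_limits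
  proof (intro allI impI, elim conjE)
    fix x l assume x: "\<forall>n. x n \<in> span (insert b Z)" and l: "x \<longlonglongrightarrow> l"
    have "\<forall>n. \<exists>c. x n - c *\<^sub>R b \<in> Z" using x unfolding span .
    then obtain c where c: "\<And>n. x n - c n *\<^sub>R b \<in> Z" by metis
    have diff: "\<bar>c m - c n\<bar> * d \<le> norm (x m - x n)" for m n
    proof (rule coeff)
      have "(x m - c m *\<^sub>R b) - (x n - c n *\<^sub>R b) \<in> Z" using Z(1) c c by (rule subspace_diff)
      then show "(x m - x n) - (c m - c n) *\<^sub>R b \<in> Z" by (simp add: algebra_simps)
    qed
    have "Cauchy c"
    proof (rule CauchyI)
      fix e :: real assume "0 < e"
      then have "0 < e * d" using d by simp
      then obtain M where "\<forall>m\<ge>M. \<forall>n\<ge>M. norm (x m - x n) < e * d"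
        using LIMSEQ_imp_Cauchy[OF l] CauchyD by blast
      then have "\<forall>m\<ge>M. \<forall>n\<ge>M. \<bar>c m - c n\<bar> * d < e * d" using diff le_less_trans by blast
      then show "\<exists>M. \<forall>m\<ge>M. \<forall>n\<ge>M. norm (c m - c n) < e" using d by auto
    qed
    then obtain c0 where "c \<longlonglongrightarrow> c0" using Cauchy_convergent convergent_def by blast
    then have "(\<lambda>n. x n - c n *\<^sub>R b) \<longlonglongrightarrow> l - c0 *\<^sub>R b" using l by (intro tendsto_intros)
    then have "l - c0 *\<^sub>R b \<in> Z" using closed_sequentially[OF Z(2) c] by simp
    then show "l \<in> span (insert b Z)" using span by blast
  qed
  moreover have "net_modulo Y (span (insert b Z))"
    unfolding net_modulo_def
  proof (intro allI impI)
    fix R \<epsilon> :: real assume \<epsilon>: "0 < \<epsilon>"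
    define r where "r = \<epsilon> / (2 * (norm b + 1))"
    have nb: "norm b + 1 > 0" by (rule add_nonneg_pos) auto
    have r: "r > 0" using \<epsilon> nb by (simp add: r_def)
    have rb: "r * norm b \<le> \<epsilon> / 2"
    proof -
      have "r * norm b \<le> r * (norm b + 1)" using r by simp
      also have "\<dots> = \<epsilon> / 2" using nb by (simp add: r_def field_simps)
      finally show ?thesis .
    qed
    have "\<exists>T. finite T \<and> T \<subseteq> {- R / d..R / d} \<and> {- R / d..R / d} \<subseteq> (\<Union>t\<in>T. ball t r)"
      by (rule seq_compact_imp_totally_bounded[rule_format, OF _ r])
        (rule compact_imp_seq_compact[OF compact_Icc])
    then obtain T where T: "finite T" "{- R / d..R / d} \<subseteq> (\<Union>t\<in>T. ball t r)" by blast
    obtain N where N: "finite N"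
      "\<And>v. v \<in> Z \<Longrightarrow> norm v \<le> R + (R / d) * norm b \<Longrightarrow> \<exists>g\<in>N. \<exists>y\<in>Y. norm (v - g - y) \<le> \<epsilon> / 2"
      using Z(3) \<epsilon> unfolding net_modulo_def by (meson half_gt_zero)
    let ?N = "(\<lambda>(g, t). g + t *\<^sub>R b) ` (N \<times> T)"
    have "\<exists>g\<in>?N. \<exists>y\<in>Y. norm (v - g - y) \<le> \<epsilon>" if v: "v \<in> span (insert b Z)" "norm v \<le> R" for v
    proof -
      obtain c where c: "v - c *\<^sub>R b \<in> Z" using v span by blast
      then have "\<bar>c\<bar> * d \<le> R" using coeff v(2) order_trans by blast
      then have cR: "\<bar>c\<bar> \<le> R / d" using d by (simp add: field_simps)
      then have "c \<in> {- R / d..R / d}" by auto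
      then obtain t where t: "t \<in> T" "\<bar>c - t\<bar> < r" using T by (auto simp: dist_real_def abs_minus_commute)
      have "norm (v - c *\<^sub>R b) \<le> norm v + \<bar>c\<bar> * norm b" by (metis norm_triangle_ineq4 norm_scaleR)
      also have "\<dots> \<le> R + (R / d) * norm b" using v(2) cR by (intro add_mono mult_right_mono) auto
      finally obtain g y where g: "g \<in> N" "y \<in> Y" "norm (v - c *\<^sub>R b - g - y) \<le> \<epsilon> / 2"
        using N(2)[OF c] by blast
      have "v - (g + t *\<^sub>R b) - y = (v - c *\<^sub>R b - g - y) + (c - t) *\<^sub>R b" by (simp add: algebra_simps)
      also have "norm \<dots> \<le> \<epsilon> / 2 + r * norm b"
        using g(3) t(2) by (intro norm_triangle_mono) (auto intro: mult_right_mono)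
      finally have "norm (v - (g + t *\<^sub>R b) - y) \<le> \<epsilon>" using rb by simp
      then show ?thesis using g t by force
    qed
    then show "\<exists>N. finite N \<and> (\<forall>v\<in>span (insert b Z). norm v \<le> R \<longrightarrow> (\<exists>g\<in>N. \<exists>y\<in>Y. norm (v - g - y) \<le> \<epsilon>))"
      by (intro exI[of _ ?N] conjI ballI impI finite_imageI finite_cartesian_product N(1) T(1))
  qed
  ultimately show ?thesis by simp
qed

lemma net_modulo_span:
  assumes Y: "subspace Y" "closed Y" and B: "finite B"
  shows "closed (span (B \<union> Y)) \<and> net_modulo Y (span (B \<union> Y))"
  using B
proof (induction B)
  case empty
  have "net_modulo Y Y"
    unfolding net_modulo_def
  proof (intro allI impI)
    fix R \<epsilon> :: real assume "0 < \<epsilon>"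
    then have "\<exists>g\<in>{0}. \<exists>y\<in>Y. norm (v - g - y) \<le> \<epsilon>" if "v \<in> Y" for v
      using that by (auto intro!: bexI[of _ v])
    then show "\<exists>N. finite N \<and> (\<forall>v\<in>Y. norm v \<le> R \<longrightarrow> (\<exists>g\<in>N. \<exists>y\<in>Y. norm (v - g - y) \<le> \<epsilon>))"
      by (intro exI[of _ "{0}"]) blast
  qed
  then show ?case using Y by (simp add: span_eq_iff[THEN iffD2])
next
  case (insert b B)
  have "span (insert b B \<union> Y) = span (insert b (span (B \<union> Y)))"
    by (simp add: span_insert[of b "B \<union> Y"] span_insert[of b "span (B \<union> Y)"] span_span)
  then show ?case using net_modulo_insert[OF subspace_span, of "B \<union> Y" Y b] insert.IH by simp
qed

lemma quasi_reflexive_span: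
  assumes "quasi_reflexive TYPE('a::banach)"
  obtains B where "finite B" "span (B \<union> range (canonical_embedding :: 'a \<Rightarrow> _)) = UNIV"
proof -
  obtain B :: "'a bidual_quotient set" where B: "finite B" "span B = UNIV"
    using assms unfolding quasi_reflexive_def by blast
  let ?J = "range (canonical_embedding :: 'a \<Rightarrow> _)"
  let ?B = "rep_bidual_quotient ` B"
  have lin: "linear (abs_bidual_quotient :: _ \<Rightarrow> 'a bidual_quotient)"
    by (intro linearI) (simp_all add: plus_bidual_quotient.abs_eq scaleR_bidual_quotient.abs_eq)
  have abs_rep: "abs_bidual_quotient (rep_bidual_quotient b) = b" for b :: "'a bidual_quotient"
    using Quotient_bidual_quotient by (rule Quotient_abs_rep)
  have "B = abs_bidual_quotient ` ?B" by (simp add: image_image abs_rep)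
  then have span: "UNIV = abs_bidual_quotient ` span ?B" using B(2) linear_span_image[OF lin, of ?B] by simp
  have "F \<in> span (?B \<union> ?J)" for F
  proof -
    have "abs_bidual_quotient F \<in> abs_bidual_quotient ` span ?B" unfolding span[symmetric] by simp
    then obtain G where G: "G \<in> span ?B" "abs_bidual_quotient F = abs_bidual_quotient G" by blast
    then have "F - G \<in> ?J" by (simp add: bidual_quotient.abs_eq_iff)
    then have "F - G \<in> span (?B \<union> ?J)" by (simp add: span_base)
    moreover have "G \<in> span (?B \<union> ?J)" using G(1) by (meson Un_upper1 span_mono subsetD)
    ultimately have "(F - G) + G \<in> span (?B \<union> ?J)" by (rule span_add)
    then show ?thesis by simp
  qed
  then show ?thesis using that[of ?B] B(1) by auto
qed


section \<open>Weakly null trees\<close>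

lemma weak_nbhds_basis:
  fixes u :: "'a::real_normed_vector set"
  assumes "u \<in> weak_nbhds"
  obtains \<Phi> \<delta> where "finite (\<Phi> :: ('a \<Rightarrow>\<^sub>L real) set)" "0 < \<delta>"
    "\<And>x. (\<And>\<phi>. \<phi> \<in> \<Phi> \<Longrightarrow> \<bar>\<phi> x\<bar> < \<delta>) \<Longrightarrow> x \<in> u"
proof -
  have "generate_topology_on {blinfun_apply f -` U | (f :: 'a \<Rightarrow>\<^sub>L real) U. open U} u" "0 \<in> u"
    using assms unfolding weak_nbhds_def weak_topology_def openin_topology_generated_by_iff by simp_all
  then have "\<exists>\<Phi> \<delta>. finite (\<Phi> :: ('a \<Rightarrow>\<^sub>L real) set) \<and> 0 < \<delta> \<and> (\<forall>x. (\<forall>\<phi>\<in>\<Phi>. \<bar>\<phi> x\<bar> < \<delta>) \<longrightarrow> x \<in> u)"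
  proof (induction)
    case Empty
    then show ?case by simp
  next
    case (Int a b)
    then have "0 \<in> a" "0 \<in> b" by auto
    obtain \<Phi> \<delta> where 1: "finite (\<Phi> :: ('a \<Rightarrow>\<^sub>L real) set)" "0 < \<delta>"
      "\<And>x. (\<forall>\<phi>\<in>\<Phi>. \<bar>\<phi> x\<bar> < \<delta>) \<Longrightarrow> x \<in> a"
      using Int.IH(1)[OF \<open>0 \<in> a\<close>] by blast
    obtain \<Phi>' \<delta>' where 2: "finite (\<Phi>' :: ('a \<Rightarrow>\<^sub>L real) set)" "0 < \<delta>'"
      "\<And>x. (\<forall>\<phi>\<in>\<Phi>'. \<bar>\<phi> x\<bar> < \<delta>') \<Longrightarrow> x \<in> b"
      using Int.IH(2)[OF \<open>0 \<in> b\<close>] by blast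
    show ?case
    proof (intro exI[of _ "\<Phi> \<union> \<Phi>'"] exI[of _ "min \<delta> \<delta>'"] conjI allI impI)
      fix x assume "\<forall>\<phi>\<in>\<Phi> \<union> \<Phi>'. \<bar>\<phi> x\<bar> < min \<delta> \<delta>'"
      then show "x \<in> a \<inter> b" by (intro IntI 1(3) 2(3)) simp_all
    qed (use 1 2 in simp_all)
  next
    case (UN K)
    then obtain a where a: "a \<in> K" "0 \<in> a" by blast
    show ?case using UN.IH[OF a] a(1) by blast
  next
    case (Basis s)
    then obtain f :: "'a \<Rightarrow>\<^sub>L real" and U where f: "s = blinfun_apply f -` U" "open U" by blast
    have "0 \<in> U" using Basis.prems unfolding f(1) by (simp add: blinfun.zero_right)
    then obtain \<delta> where \<delta>: "0 < \<delta>" "ball 0 \<delta> \<subseteq> U" using f(2) open_contains_ball by blast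
    show ?case
    proof (intro exI[of _ "{f}"] exI[of _ \<delta>] conjI allI impI)
      fix x assume "\<forall>\<phi>\<in>{f}. \<bar>\<phi> x\<bar> < \<delta>"
      then have "f x \<in> ball 0 \<delta>" by simp
      then show "x \<in> s" using \<delta>(2) unfolding f(1) by blast
    qed (use \<delta>(1) in simp_all)
  qed
  then obtain \<Phi> \<delta> where "finite (\<Phi> :: ('a \<Rightarrow>\<^sub>L real) set)" "0 < \<delta>"
    "\<forall>x. (\<forall>\<phi>\<in>\<Phi>. \<bar>\<phi> x\<bar> < \<delta>) \<longrightarrow> x \<in> u" by blast
  then show ?thesis by (intro that[of \<Phi> \<delta>]) simp_all
qed

text \<open>The only way in which \<open>theta0\<close> enters.  Suppose that a state can be extended \<open>k\<close> times, each
  time so that the new vector \<open>val s'\<close> of the unit ball lies in a prescribed weak neighbourhood.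
  Answering every sequence of neighbourhoods by such extensions yields a weakly null tree in the
  unit ball, and a branch on which the norm of the sum is almost minimal gives the states \<open>S\<close>.\<close>

lemma weakly_null_branch:
  fixes Inv :: "nat \<Rightarrow> 's \<Rightarrow> bool" and val :: "'s \<Rightarrow> 'a::real_normed_vector"
  assumes k: "1 \<le> k" and \<eta>: "0 < \<eta>" and s0: "Inv 0 s0"
    and step: "\<And>j s u. j < k \<Longrightarrow> Inv j s \<Longrightarrow> u \<in> weak_nbhds \<Longrightarrow>
      \<exists>s'. R s s' \<and> Inv (Suc j) s' \<and> val s' \<in> u \<and> norm (val s') \<le> 1"
  obtains S where "S 0 = s0" "\<And>j. j < k \<Longrightarrow> R (S j) (S (Suc j))" "\<And>j. j \<le> k \<Longrightarrow> Inv j (S j)"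
    "norm (\<Sum>i<k. val (S (Suc i))) \<le> k * theta0 k (id_blinfun :: 'a \<Rightarrow>\<^sub>L 'a) + \<eta>"
proof -
  define next_state where "next_state j s u = (SOME s'. R s s' \<and> Inv (Suc j) s' \<and> val s' \<in> u \<and> norm (val s') \<le> 1)"
    for j s u
  have nxt: "R s (next_state j s u)" "Inv (Suc j) (next_state j s u)" "val (next_state j s u) \<in> u"
    "norm (val (next_state j s u)) \<le> 1" if "j < k" "Inv j s" "u \<in> weak_nbhds" for j s u
    using someI_ex[OF step[OF that]] unfolding next_state_def by blast+
  \<comment> \<open>The first component of the state records the depth.\<close>
  define \<sigma> where "\<sigma> = foldl (\<lambda>p u. (Suc (fst p), next_state (fst p) (snd p) u)) (0, s0)"
  have \<sigma>_snoc: "\<sigma> (t @ [u]) = (Suc (fst (\<sigma> t)), next_state (fst (\<sigma> t)) (snd (\<sigma> t)) u)" for t u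
    by (simp add: \<sigma>_def)
  have len: "fst (\<sigma> t) = length t" for t
    by (induction t rule: rev_induct) (simp_all add: \<sigma>_snoc, simp add: \<sigma>_def)
  have Inv: "Inv (length t) (snd (\<sigma> t))" if "t \<in> lists weak_nbhds" "length t \<le> k" for t
    using that
  proof (induction t rule: rev_induct)
    case Nil then show ?case using s0 by (simp add: \<sigma>_def)
  next
    case (snoc u t) then show ?case by (simp add: \<sigma>_snoc len nxt)
  qed
  define x where "x t = val (snd (\<sigma> t))" for t
  have x: "x (t @ [u]) \<in> u" "norm (x (t @ [u])) \<le> 1" "R (snd (\<sigma> t)) (snd (\<sigma> (t @ [u])))"
    if "t \<in> lists weak_nbhds" "length t < k" "u \<in> weak_nbhds" for t u
    using nxt[OF that(2) Inv that(3)] that by (simp_all add: x_def \<sigma>_snoc len)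
  have "unit_ball_tree k x"
    unfolding unit_ball_tree_def
  proof (intro ballI impI)
    fix t assume t: "t \<in> lists (weak_nbhds :: 'a set set)" "1 \<le> length t \<and> length t \<le> k"
    then obtain t' u where "t = t' @ [u]" by (cases t rule: rev_exhaust) auto
    with t show "x t \<in> cball 0 1" using x(2)[of t' u] by simp
  qed
  moreover have "weakly_null_tree k x"
    unfolding weakly_null_tree_def limitin_def
  proof (intro ballI impI conjI allI)
    fix t assume t: "t \<in> lists (weak_nbhds :: 'a set set)" "length t < k"
    show "0 \<in> topspace (weak_topology :: 'a topology)"
      using weak_nbhds_UNIV openin_subset unfolding weak_nbhds_def by blast
    fix U assume "openin weak_topology U \<and> (0 :: 'a) \<in> U"
    then have "U \<in> weak_nbhds" by (simp add: weak_nbhds_def)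
    then show "\<forall>\<^sub>F u in weak_net. x (t @ [u]) \<in> U"
      unfolding weak_net_def
      by (rule eventually_INF1) (use x(1)[OF t] in \<open>auto simp: eventually_principal\<close>)
  qed
  ultimately have tv: "(INF t\<in>{t \<in> lists weak_nbhds. length t = k}.
        norm (id_blinfun (\<Sum>i<k. Poly_Mapping.lookup a i *\<^sub>R x (take (Suc i) t)))) \<in> tree_values (id_blinfun :: 'a \<Rightarrow>\<^sub>L 'a) a" for a
    unfolding tree_values_def using k by blast
  define a :: "nat \<Rightarrow>\<^sub>0 real" where "a = (\<Sum>i<k. Poly_Mapping.single i (1 / real k))"
  have a: "Poly_Mapping.lookup a i = 1 / k" if "i < k" for i
  proof -
    have "Poly_Mapping.lookup a i = (\<Sum>j<k. Poly_Mapping.lookup (Poly_Mapping.single j (1 / real k)) i)"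
      unfolding a_def by (rule lookup_sum)
    also have "\<dots> = 1 / k" using that by (simp add: lookup_single when_def)
    finally show ?thesis .
  qed
  have nrm: "norm (id_blinfun (\<Sum>i<k. Poly_Mapping.lookup a i *\<^sub>R x (take (Suc i) t)))
      = norm (\<Sum>i<k. x (take (Suc i) t)) / k" for t
  proof -
    have "(\<Sum>i<k. Poly_Mapping.lookup a i *\<^sub>R x (take (Suc i) t)) = (1 / k) *\<^sub>R (\<Sum>i<k. x (take (Suc i) t))"
      unfolding scaleR_sum_right by (intro sum.cong) (auto simp: a)
    then show ?thesis by simp
  qed
  have "(INF t\<in>{t \<in> lists weak_nbhds. length t = k}. norm (\<Sum>i<k. x (take (Suc i) t)) / k)
      \<le> theta0 k (id_blinfun :: 'a \<Rightarrow>\<^sub>L 'a)"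
    using cSup_upper[OF tv[of a] tree_values_bdd_above]
    unfolding nrm theta0_def norm0_def a_def[symmetric] .
  also have "\<dots> < theta0 k (id_blinfun :: 'a \<Rightarrow>\<^sub>L 'a) + \<eta> / k" using \<eta> k by simp
  finally have inf: "(INF t\<in>{t \<in> lists weak_nbhds. length t = k}. norm (\<Sum>i<k. x (take (Suc i) t)) / k)
     < theta0 k (id_blinfun :: 'a \<Rightarrow>\<^sub>L 'a) + \<eta> / k" .
  have "replicate k UNIV \<in> {t \<in> lists (weak_nbhds :: 'a set set). length t = k}"
    using weak_nbhds_UNIV by (auto simp: in_lists_conv_set)
  then have "\<exists>t\<in>{t \<in> lists weak_nbhds. length t = k}. norm (\<Sum>i<k. x (take (Suc i) t)) / k
     < theta0 k (id_blinfun :: 'a \<Rightarrow>\<^sub>L 'a) + \<eta> / k"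
    using inf by (subst (asm) cINF_less_iff) (auto intro!: bdd_belowI[of _ 0])
  then obtain t where t: "t \<in> lists weak_nbhds" "length t = k"
    "norm (\<Sum>i<k. x (take (Suc i) t)) / k < theta0 k (id_blinfun :: 'a \<Rightarrow>\<^sub>L 'a) + \<eta> / k" by blast
  have tk: "take j t \<in> lists weak_nbhds" for j using t(1) by (auto simp: in_lists_conv_set dest: in_set_takeD)
  show ?thesis
  proof (rule that[of "\<lambda>j. snd (\<sigma> (take j t))"])
    show "snd (\<sigma> (take 0 t)) = s0" by (simp add: \<sigma>_def)
    show "R (snd (\<sigma> (take j t))) (snd (\<sigma> (take (Suc j) t)))" if "j < k" for j
      using x(3)[OF tk[of j], of "t ! j"] that t by (auto simp: take_Suc_conv_app_nth in_lists_conv_set)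
    show "Inv j (snd (\<sigma> (take j t)))" if "j \<le> k" for j
      using Inv[OF tk[of j]] that t(2) by simp
    show "norm (\<Sum>i<k. val (snd (\<sigma> (take (Suc i) t)))) \<le> k * theta0 k (id_blinfun :: 'a \<Rightarrow>\<^sub>L 'a) + \<eta>"
      using t(3) k by (simp add: x_def field_simps)
  qed
qed


section \<open>Iterated limits\<close>

text \<open>The iterated limit of \<open>h (s @ [n\<^sub>1, \<dots>, n\<^sub>r])\<close>, where \<open>L\<close> is the limit operator for
  sequences; the limit in the last variable \<open>n\<^sub>r\<close> is taken first.\<close>

primrec iterated_limit :: "((nat \<Rightarrow> 'c) \<Rightarrow> 'c) \<Rightarrow> nat \<Rightarrow> (nat list \<Rightarrow> 'c) \<Rightarrow> nat list \<Rightarrow> 'c" where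
  "iterated_limit L 0 h s = h s"
| "iterated_limit L (Suc r) h s = L (\<lambda>n. iterated_limit L r h (s @ [n]))"

text \<open>The weak* limit along \<open>U\<close>, an arbitrary value if there is none; it is unique if \<open>U\<close> is a
  proper filter.\<close>

definition wstar_lim :: "'i filter \<Rightarrow> ('i \<Rightarrow> 'b::real_normed_vector \<Rightarrow>\<^sub>L real) \<Rightarrow> 'b \<Rightarrow>\<^sub>L real" where
  "wstar_lim U g = (SOME l. wstar_tendsto l U g)"

text \<open>The value that \<open>h\<close> takes on a set of \<open>U\<close>, an arbitrary value if there is none.\<close>

definition colour_lim :: "'i filter \<Rightarrow> ('i \<Rightarrow> 'c) \<Rightarrow> 'c" where
  "colour_lim U h = (SOME c. eventually (\<lambda>n. h n = c) U)"

context
  fixes U :: "nat filter" and h :: "nat list \<Rightarrow> 'b::real_normed_vector \<Rightarrow>\<^sub>L real" and b :: real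
  assumes U: "ultra U" and b: "\<And>s. norm (h s) \<le> b"
begin

lemma iterated_wstar_limit:
  "norm (iterated_limit (wstar_lim U) r h s) \<le> b"
  "wstar_tendsto (iterated_limit (wstar_lim U) (Suc r) h s) U
     (\<lambda>n. iterated_limit (wstar_lim U) r h (s @ [n]))"
proof -
  have *: "wstar_tendsto (wstar_lim U g) U g" if "\<And>n. norm (g n) \<le> b" for g :: "nat \<Rightarrow> 'b \<Rightarrow>\<^sub>L real"
    unfolding wstar_lim_def using ultra_wstar_limit[OF U that] by (rule someI_ex)
  have bound: "norm (iterated_limit (wstar_lim U) r h s) \<le> b" for r s
  proof (induction r arbitrary: s)
    case (Suc r)
    show ?case
      using wstar_tendsto_norm_le[OF _ *[OF Suc.IH] Suc.IH] U by (simp add: ultra_def)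
  qed (simp add: b)
  then show "norm (iterated_limit (wstar_lim U) r h s) \<le> b" .
  show "wstar_tendsto (iterated_limit (wstar_lim U) (Suc r) h s) U
     (\<lambda>n. iterated_limit (wstar_lim U) r h (s @ [n]))"
    using *[OF bound] by simp
qed

lemma iterated_wstar_limit_lipschitz:
  assumes lip: "\<And>a x y c. norm (h (a @ x # c) - h (a @ y # c)) \<le> 1"
  shows "norm (iterated_limit (wstar_lim U) r h (a @ x # c) - iterated_limit (wstar_lim U) r h (a @ y # c)) \<le> 1"
proof (induction r arbitrary: c)
  case (Suc r)
  have "U \<noteq> bot" using U by (simp add: ultra_def)
  then show ?case
    by (rule wstar_tendsto_norm_le[OF _ wstar_tendsto_diff[OF iterated_wstar_limit(2) iterated_wstar_limit(2)]])
      (use Suc.IH[of "c @ _"] in simp)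
qed (simp add: lip)

text \<open>The increments of the iterated limits are weak* null in the last index, and by weak* lower
  semicontinuity of the norm they inherit the bound on the variation in one coordinate.\<close>

lemma iterated_wstar_limit_increment:
  defines "F \<equiv> \<lambda>r. iterated_limit (wstar_lim U) r h"
  shows "wstar_tendsto 0 U (\<lambda>n. F r (s @ [n]) - F (Suc r) s)"
    and "(\<And>a x y c. norm (h (a @ x # c) - h (a @ y # c)) \<le> 1) \<Longrightarrow> norm (F r (s @ [n]) - F (Suc r) s) \<le> 1"
proof -
  have const: "wstar_tendsto l U (\<lambda>_. l)" for l :: "'b \<Rightarrow>\<^sub>L real" by (simp add: wstar_tendsto_def)
  have lim: "wstar_tendsto (F (Suc r) s) U (\<lambda>n. F r (s @ [n]))"
    unfolding F_def by (rule iterated_wstar_limit(2))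
  show "wstar_tendsto 0 U (\<lambda>n. F r (s @ [n]) - F (Suc r) s)"
    using wstar_tendsto_diff[OF lim const[of "F (Suc r) s"]] by simp
  assume lip: "\<And>a x y c. norm (h (a @ x # c) - h (a @ y # c)) \<le> 1"
  have "U \<noteq> bot" using U by (simp add: ultra_def)
  then show "norm (F r (s @ [n]) - F (Suc r) s) \<le> 1"
    by (rule wstar_tendsto_norm_le[OF _ wstar_tendsto_diff[OF const lim]])
      (simp add: F_def iterated_wstar_limit_lipschitz[OF lip])
qed

end

lemma iterated_colour_limit:
  assumes U: "ultra U" and N: "finite N" "\<And>s. \<kappa> s \<in> N"
  shows "eventually (\<lambda>n. iterated_limit (colour_lim U) r \<kappa> (s @ [n]) =
    iterated_limit (colour_lim U) (Suc r) \<kappa> s) U"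
proof -
  have *: "eventually (\<lambda>n. h n = colour_lim U h) U" if "\<And>n. h n \<in> N" for h :: "nat \<Rightarrow> 'a"
    unfolding colour_lim_def using ultra_colour[OF U N(1) that] by (rule someI_ex)
  have "iterated_limit (colour_lim U) r \<kappa> s \<in> N" for r s
  proof (induction r arbitrary: s)
    case (Suc r)
    have "U \<noteq> bot" using U by (simp add: ultra_def)
    then obtain n where "iterated_limit (colour_lim U) r \<kappa> (s @ [n]) = iterated_limit (colour_lim U) (Suc r) \<kappa> s"
      using eventually_happens'[OF _ *[of "\<lambda>n. iterated_limit (colour_lim U) r \<kappa> (s @ [n])", OF Suc.IH]]
      by auto
    then show ?case using Suc.IH by metis
  qed (simp add: N)
  from *[OF this] show ?thesis by simp
qed


section \<open>Interlaced pairs with small difference\<close>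

lemma interlaced_snoc:
  assumes "interlaced j m n" "length m = j" "length n = j" "x < y" "\<And>i. i \<in> set n \<Longrightarrow> i < x"
  shows "interlaced (Suc j) (m @ [x]) (n @ [y])"
  using assms by (auto simp: interlaced_def nth_append less_Suc_eq)

text \<open>An element of the bidual near the space and small on finitely many functionals is near a vector
  of the space that is small on these functionals: correct any nearby vector \<open>x\<close> by a vector \<open>z\<close>
  that imitates the error, which Goldstine's theorem provides without losing smallness.\<close>

lemma weakly_small_approximant:
  fixes D :: "('a::real_normed_vector \<Rightarrow>\<^sub>L real) \<Rightarrow>\<^sub>L real"
  assumes x: "norm (D - canonical_embedding x) \<le> r" and r: "0 < r"
    and \<Phi>: "finite \<Phi>" and \<delta>: "0 < \<delta>" and small: "\<And>\<phi>. \<phi> \<in> \<Phi> \<Longrightarrow> \<bar>D \<phi>\<bar> < \<delta>"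
  obtains y where "norm (D - canonical_embedding y) \<le> 2 * r" "\<And>\<phi>. \<phi> \<in> \<Phi> \<Longrightarrow> \<bar>\<phi> y\<bar> < 2 * \<delta>"
proof -
  let ?E = "canonical_embedding x - D"
  have "norm ?E \<le> r" using x by (simp add: norm_minus_commute)
  then obtain z where z: "norm z \<le> r" "\<And>\<phi>. \<phi> \<in> \<Phi> \<Longrightarrow> \<bar>\<phi> z - ?E \<phi>\<bar> < \<delta>"
    using goldstine[OF _ r \<Phi> \<delta>] by blast
  show ?thesis
  proof (rule that[of "x - z"])
    have "D - canonical_embedding (x - z) = (D - canonical_embedding x) + canonical_embedding z"
      by (simp add: linear_diff[OF linear_canonical_embedding])
    also have "norm \<dots> \<le> r + r" using x z(1) by (intro norm_triangle_mono) simp_all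
    finally show "norm (D - canonical_embedding (x - z)) \<le> 2 * r" by simp
    show "\<bar>\<phi> (x - z)\<bar> < 2 * \<delta>" if "\<phi> \<in> \<Phi>" for \<phi>
      using z(2)[OF that] small[OF that] by (simp add: blinfun.diff_left blinfun.diff_right)
  qed
qed

text \<open>The heart of the argument: in every infinite set of indices some interlaced pair satisfies the
  estimate.  For a list \<open>s\<close> of length \<open>j\<close>, \<open>F (k - j) s\<close> is the iterated weak* limit of \<open>f\<close> over
  the remaining \<open>k - j\<close> coordinates and \<open>D s\<close> is its increment in the last coordinate of \<open>s\<close>.  The
  increments have norm at most \<open>1\<close> and are weak* null, but lie in the bidual.  The colour \<open>\<kappa> s\<close>
  is a point of a finite net that represents the class of \<open>D s\<close> modulo the space.  The lists
  \<open>m\<close> and \<open>n\<close> are extended along the ultrafilter so that their colours at each level equal the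
  iterated limit of the colours (\<open>stable\<close>); then \<open>D m - D n\<close> is close to the space and may be
  replaced by a weakly small vector \<open>y\<close>.  States are triples \<open>(m, n, y)\<close>.\<close>

lemma exists_interlaced_pair:
  fixes f :: "nat list \<Rightarrow> 'a::banach"
  assumes qr: "quasi_reflexive TYPE('a)" and k: "1 \<le> k" and M: "infinite M"
    and b: "\<And>s. norm (f s) \<le> b"
    and lip: "\<And>a x y c. norm (f (a @ x # c) - f (a @ y # c)) \<le> 1"
  obtains m n where "length m = k" "length n = k" "set m \<subseteq> M" "set n \<subseteq> M" "interlaced k m n"
    "norm (f m - f n) \<le> 3 * (k * theta0 k (id_blinfun :: 'a \<Rightarrow>\<^sub>L 'a)) + 2"
proof -
  let ?J = "canonical_embedding :: 'a \<Rightarrow> _"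
  note J_diff = linear_diff[OF linear_canonical_embedding]
  have "inf sequentially (principal M) \<noteq> bot"
    using M unfolding trivial_limit_def eventually_inf_principal
    by (auto simp: eventually_sequentially infinite_nat_iff_unbounded_le)
  then obtain U where U: "ultra U" "U \<le> inf sequentially (principal M)" by (rule ex_ultra)
  have Useq: "eventually P U" if "eventually P sequentially" for P
    using U(2) that filter_leD by (metis le_inf_iff)
  have UM: "eventually (\<lambda>n. n \<in> M) U" using U(2) by (simp add: le_principal)
  have Unb: "U \<noteq> bot" using U(1) by (simp add: ultra_def)
  define h where "h s = ?J (f s)" for s
  have hb: "norm (h s) \<le> b" for s by (simp add: h_def b)
  have hlip: "norm (h (a @ x # c) - h (a @ y # c)) \<le> 1" for a x y c
    using lip unfolding h_def J_diff[symmetric] by simp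
  define F where "F r = iterated_limit (wstar_lim U) r h" for r
  have Fb: "norm (F r s) \<le> b" for r s
    unfolding F_def by (rule iterated_wstar_limit(1)[OF U(1) hb])
  define D where "D s = F (k - length s) s - F (Suc (k - length s)) (butlast s)" for s
  have D0: "wstar_tendsto 0 U (\<lambda>n. D (s @ [n]))" for s
    unfolding D_def F_def using iterated_wstar_limit_increment(1)[where h = h and b = b, OF U(1) hb] by simp
  have D1: "norm (D (s @ [n])) \<le> 1" for s n
    unfolding D_def F_def using iterated_wstar_limit_increment(2)[where h = h and b = b, OF U(1) hb hlip] by simp
  \<comment> \<open>This cruder bound includes the empty list.\<close>
  have Db: "norm (D s) \<le> 2 * b" for s
    using norm_triangle_ineq4[of "F (k - length s) s"] Fb unfolding D_def
    by (smt (verit))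
  \<comment> \<open>Each of the \<open>k\<close> increments is replaced with error \<open>4 * \<epsilon>\<close>, so that the total error is \<open>1\<close>.\<close>
  define \<epsilon> where "\<epsilon> = 1 / (4 * real k)"
  have \<epsilon>: "\<epsilon> > 0" "4 * \<epsilon> = 1 / k" "4 * \<epsilon> \<le> 1" using k by (auto simp: \<epsilon>_def)
  obtain B where B: "finite B" "span (B \<union> range ?J) = UNIV" using qr by (rule quasi_reflexive_span)
  have net: "net_modulo (range ?J) UNIV"
    using net_modulo_span[OF subspace_range_canonical_embedding closed_range_canonical_embedding B(1)]
    unfolding B(2) by blast
  obtain N where N: "finite N \<and> (\<forall>v\<in>UNIV. norm v \<le> 2 * b \<longrightarrow> (\<exists>g\<in>N. \<exists>y\<in>range ?J. norm (v - g - y) \<le> \<epsilon>))"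
    using net[unfolded net_modulo_def, THEN spec, THEN spec, THEN mp, OF \<epsilon>(1)] ..
  have "\<exists>g. g \<in> N \<and> (\<exists>y. norm (D s - g - ?J y) \<le> \<epsilon>)" for s
    using N[THEN conjunct2, THEN bspec, OF UNIV_I, of "D s"] Db[of s] by blast
  then have "\<forall>s. \<exists>g. g \<in> N \<and> (\<exists>y. norm (D s - g - ?J y) \<le> \<epsilon>)" ..
  then obtain \<kappa> where \<kappa>: "\<And>s. \<kappa> s \<in> N" "\<And>s. \<exists>y. norm (D s - \<kappa> s - ?J y) \<le> \<epsilon>" by metis
  define C where "C r = iterated_limit (colour_lim U) r \<kappa>" for r
  have C0: "C 0 = \<kappa>" by (simp add: C_def fun_eq_iff)
  have C: "eventually (\<lambda>n. C r (s @ [n]) = C (Suc r) s) U" for r s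
    unfolding C_def by (rule iterated_colour_limit[OF U(1) N[THEN conjunct1] \<kappa>(1)])
  have small: "eventually (\<lambda>n. \<forall>\<phi>\<in>\<Phi>. \<bar>D (s @ [n]) \<phi>\<bar> < \<delta>) U" if "finite \<Phi>" "0 < \<delta>" for \<Phi> \<delta> s
  proof (rule eventually_ball_finite[OF that(1)], rule ballI)
    fix \<phi>
    have "((\<lambda>n. D (s @ [n]) \<phi>) \<longlongrightarrow> 0) U" using D0[of s] by (simp add: wstar_tendsto_def)
    then show "eventually (\<lambda>n. \<bar>D (s @ [n]) \<phi>\<bar> < \<delta>) U" using that(2) tendstoD by fastforce
  qed
  define stable where "stable s \<longleftrightarrow> (\<forall>l\<in>{length s..k}. C (l - length s) s = C l [])" for s
  have stable_snoc: "eventually (\<lambda>n. stable (s @ [n])) U" if "stable s" "length s < k" for s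
  proof -
    have "eventually (\<lambda>n. \<forall>l\<in>{Suc (length s)..k}. C (l - Suc (length s)) (s @ [n]) = C (Suc (l - Suc (length s))) s) U"
      by (rule eventually_ball_finite) (use C in auto)
    then show ?thesis
    proof (rule eventually_mono)
      fix n assume *: "\<forall>l\<in>{Suc (length s)..k}. C (l - Suc (length s)) (s @ [n]) = C (Suc (l - Suc (length s))) s"
      show "stable (s @ [n])"
        unfolding stable_def
      proof
        fix l assume l: "l \<in> {length (s @ [n])..k}"
        then have "C (l - length (s @ [n])) (s @ [n]) = C (l - length s) s"
          using *[rule_format, of l] by (simp add: Suc_diff_Suc)
        also have "\<dots> = C l []" using that(1) l unfolding stable_def by simp
        finally show "C (l - length (s @ [n])) (s @ [n]) = C l []" .
      qed
    qed
  qed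
  define next_index where "next_index \<Phi> \<delta> s P n \<longleftrightarrow> n \<in> M \<and> P n \<and> stable (s @ [n]) \<and> (\<forall>\<phi>\<in>\<Phi>. \<bar>D (s @ [n]) \<phi>\<bar> < \<delta>)"
    for \<Phi> \<delta> s P n
  have next_index: "\<exists>n. next_index \<Phi> \<delta> s P n"
    if "finite \<Phi>" "0 < \<delta>" "stable s" "length s < k" "eventually P sequentially" for \<Phi> \<delta> s P
    by (rule eventually_happens'[OF Unb])
      (unfold next_index_def, intro eventually_conj UM Useq that stable_snoc small)
  define Inv :: "nat \<Rightarrow> nat list \<times> nat list \<times> 'a \<Rightarrow> bool" where
    "Inv j = (\<lambda>(m, n, y). length m = j \<and> length n = j \<and> set m \<subseteq> M \<and> set n \<subseteq> M \<and>
      interlaced j m n \<and> stable m \<and> stable n)" for j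
  define R :: "nat list \<times> nat list \<times> 'a \<Rightarrow> nat list \<times> nat list \<times> 'a \<Rightarrow> bool" where
    "R = (\<lambda>(m, n, y) (m', n', y'). butlast m' = m \<and> butlast n' = n \<and> norm (D m' - D n' - ?J y') \<le> 1 / k)"
  \<comment> \<open>The vectors \<open>y\<close> have norm at most \<open>1 + 1 + 4 * \<epsilon> \<le> 3\<close>.\<close>
  define val :: "nat list \<times> nat list \<times> 'a \<Rightarrow> 'a" where "val = (\<lambda>(m, n, y). (1 / 3) *\<^sub>R y)"
  have Inv0: "Inv 0 ([], [], 0)" by (simp add: Inv_def interlaced_def stable_def)
  have extend: "\<exists>s'. R s s' \<and> Inv (Suc j) s' \<and> val s' \<in> u \<and> norm (val s') \<le> 1"
    if j: "j < k" and s: "Inv j s" and u: "u \<in> weak_nbhds" for j s u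
  proof -
    obtain m n y0 where s_eq: "s = (m, n, y0)" by (cases s)
    with s have mn: "length m = j" "length n = j" "set m \<subseteq> M" "set n \<subseteq> M" "interlaced j m n"
      "stable m" "stable n" by (auto simp: Inv_def)
    obtain \<Phi> \<delta> where \<Phi>: "finite (\<Phi> :: ('a \<Rightarrow>\<^sub>L real) set)" "0 < \<delta>"
      "\<And>x. (\<And>\<phi>. \<phi> \<in> \<Phi> \<Longrightarrow> \<bar>\<phi> x\<bar> < \<delta>) \<Longrightarrow> x \<in> u" using weak_nbhds_basis[OF u] by blast
    have "eventually (\<lambda>x. \<forall>i\<in>set n. i < x) sequentially"
      by (rule eventually_ball_finite) (auto simp: eventually_gt_at_top)
    then obtain p where p: "next_index \<Phi> (\<delta> / 2) m (\<lambda>x. \<forall>i\<in>set n. i < x) p"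
      using next_index[OF \<Phi>(1) _ mn(6)] \<Phi>(2) mn(1) j by (meson half_gt_zero)
    obtain q where q: "next_index \<Phi> (\<delta> / 2) n (\<lambda>x. p < x) q"
      using next_index[OF \<Phi>(1) _ mn(7) _ eventually_gt_at_top] \<Phi>(2) mn(2) j by (meson half_gt_zero)
    let ?m = "m @ [p]" and ?n = "n @ [q]"
    let ?D = "D ?m - D ?n"
    have st: "stable ?m" "stable ?n" using p q by (auto simp: next_index_def)
    have "\<kappa> ?m = C (Suc j) []" "\<kappa> ?n = C (Suc j) []"
      using st mn(1,2) j unfolding stable_def C0[symmetric] by force+
    then have same: "\<kappa> ?m = \<kappa> ?n" by simp
    obtain y1 y2 where y: "norm (D ?m - \<kappa> ?m - ?J y1) \<le> \<epsilon>" "norm (D ?n - \<kappa> ?n - ?J y2) \<le> \<epsilon>"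
      using \<kappa>(2) by blast
    have "?D - ?J (y1 - y2) = (D ?m - \<kappa> ?m - ?J y1) - (D ?n - \<kappa> ?n - ?J y2)"
      by (simp add: same J_diff algebra_simps)
    also have "norm \<dots> \<le> 2 * \<epsilon>" by (rule norm_triangle_le_diff) (use y in simp)
    finally have near: "norm (?D - ?J (y1 - y2)) \<le> 2 * \<epsilon>" .
    have sm: "\<bar>?D \<phi>\<bar> < \<delta>" if "\<phi> \<in> \<Phi>" for \<phi>
    proof -
      have "\<bar>D ?m \<phi>\<bar> < \<delta> / 2" "\<bar>D ?n \<phi>\<bar> < \<delta> / 2" using p q that by (auto simp: next_index_def)
      then show ?thesis by (simp add: blinfun.diff_left)
    qed
    obtain y where y: "norm (?D - ?J y) \<le> 2 * (2 * \<epsilon>)" "\<And>\<phi>. \<phi> \<in> \<Phi> \<Longrightarrow> \<bar>\<phi> y\<bar> < 2 * \<delta>"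
      by (rule weakly_small_approximant[OF near _ \<Phi>(1,2) sm]) (use \<epsilon> in simp_all)
    have "norm y = norm (?D - (?D - ?J y))" by simp
    also have "\<dots> \<le> norm ?D + norm (?D - ?J y)" by (rule norm_triangle_ineq4)
    also have "norm ?D \<le> 1 + 1" using norm_triangle_le_diff[of "D ?m" "D ?n" 2] D1[of m p] D1[of n q] by simp
    finally have y3: "norm y \<le> 3" using y(1) \<epsilon>(3) by simp
    have "R s (?m, ?n, y)" using y(1) \<epsilon>(2) by (simp add: R_def s_eq)
    moreover have "Inv (Suc j) (?m, ?n, y)"
      using mn st p q interlaced_snoc[OF mn(5,1,2)] by (simp add: Inv_def next_index_def)
    moreover have "val (?m, ?n, y) \<in> u"
    proof (rule \<Phi>(3))
      fix \<phi> assume "\<phi> \<in> \<Phi>"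
      then show "\<bar>\<phi> (val (?m, ?n, y))\<bar> < \<delta>" using y(2)[of \<phi>] \<Phi>(2) by (simp add: val_def blinfun.scaleR_right)
    qed
    moreover have "norm (val (?m, ?n, y)) \<le> 1" using y3 by (simp add: val_def)
    ultimately show ?thesis by blast
  qed
  obtain S where S: "S 0 = ([], [], 0)" "\<And>j. j < k \<Longrightarrow> R (S j) (S (Suc j))" "\<And>j. j \<le> k \<Longrightarrow> Inv j (S j)"
    "norm (\<Sum>i<k. val (S (Suc i))) \<le> k * theta0 k (id_blinfun :: 'a \<Rightarrow>\<^sub>L 'a) + 1 / 3"
    by (rule weakly_null_branch[where Inv = Inv and R = R and val = val and \<eta> = "1 / 3", OF k _ Inv0 extend]) simp_all
  define m where "m j = fst (S j)" for j
  define n where "n j = fst (snd (S j))" for j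
  define y where "y j = snd (snd (S j))" for j
  have S_eq: "S j = (m j, n j, y j)" for j by (simp add: m_def n_def y_def)
  have R: "butlast (m (Suc j)) = m j" "butlast (n (Suc j)) = n j"
    "norm (D (m (Suc j)) - D (n (Suc j)) - ?J (y (Suc j))) \<le> 1 / k" if "j < k" for j
    using S(2)[OF that] by (simp_all add: S_eq R_def)
  have Inv: "length (m j) = j" "length (n j) = j" "set (m j) \<subseteq> M" "set (n j) \<subseteq> M" "interlaced j (m j) (n j)"
    if "j \<le> k" for j using S(3)[OF that] by (simp_all add: S_eq Inv_def)
  \<comment> \<open>The increments telescope; the two constants \<open>F k []\<close> cancel.\<close>
  have tele: "F (k - j) (m j) - F (k - j) (n j) = (\<Sum>i<j. D (m (Suc i)) - D (n (Suc i)))" if "j \<le> k" for j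
    using that
  proof (induction j)
    case 0
    then show ?case using S(1) by (simp add: S_eq)
  next
    case (Suc j)
    then have "D (m (Suc j)) = F (k - Suc j) (m (Suc j)) - F (k - j) (m j)"
      "D (n (Suc j)) = F (k - Suc j) (n (Suc j)) - F (k - j) (n j)"
      using Inv[of "Suc j"] R[of j] by (simp_all add: D_def Suc_diff_Suc)
    moreover have "F (k - j) (m j) - F (k - j) (n j) = (\<Sum>i<j. D (m (Suc i)) - D (n (Suc i)))"
      using Suc by simp
    ultimately show ?case by (simp flip: \<open>F (k - j) (m j) - F (k - j) (n j) = _\<close>)
  qed
  have "?J (f (m k)) - ?J (f (n k)) = (\<Sum>i<k. D (m (Suc i)) - D (n (Suc i)))"
    using tele[of k] by (simp add: F_def h_def)
  then have "?J (f (m k) - f (n k) - (\<Sum>i<k. y (Suc i))) = (\<Sum>i<k. D (m (Suc i)) - D (n (Suc i)) - ?J (y (Suc i)))"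
    by (simp add: J_diff linear_sum[OF linear_canonical_embedding] sum_subtractf)
  moreover have "norm (\<Sum>i<k. D (m (Suc i)) - D (n (Suc i)) - ?J (y (Suc i))) \<le> (\<Sum>i<k. 1 / k)"
    using R(3) by (intro sum_norm_le) auto
  moreover have "(\<Sum>i<k. 1 / real k) = 1" using k by simp
  ultimately have "norm (?J (f (m k) - f (n k) - (\<Sum>i<k. y (Suc i)))) \<le> 1" by simp
  then have "norm (f (m k) - f (n k) - (\<Sum>i<k. y (Suc i))) \<le> 1" by simp
  moreover have "norm (\<Sum>i<k. y (Suc i)) \<le> 3 * (k * theta0 k (id_blinfun :: 'a \<Rightarrow>\<^sub>L 'a)) + 1"
  proof -
    have "(\<Sum>i<k. val (S (Suc i))) = (1 / 3) *\<^sub>R (\<Sum>i<k. y (Suc i))"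
      by (simp add: S_eq val_def scaleR_sum_right)
    then show ?thesis using S(4) by simp
  qed
  ultimately have "norm (f (m k) - f (n k)) \<le> 3 * (k * theta0 k (id_blinfun :: 'a \<Rightarrow>\<^sub>L 'a)) + 2"
    using norm_triangle_ineq[of "f (m k) - f (n k) - (\<Sum>i<k. y (Suc i))" "\<Sum>i<k. y (Suc i)"] by simp
  then show ?thesis using that[of "m k" "n k"] Inv[of k] by blast
qed


section \<open>Ramsey's theorem for interlaced pairs\<close>

text \<open>The list \<open>m\<^sub>1, n\<^sub>1, \<dots>, m\<^sub>k, n\<^sub>k\<close>.  For an interlaced pair it is strictly increasing, so the
  pair can be recovered from its set of entries.\<close>

definition interleave :: "nat \<Rightarrow> nat list \<Rightarrow> nat list \<Rightarrow> nat list" where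
  "interleave k m n = map (\<lambda>i. if even i then m ! (i div 2) else n ! (i div 2)) [0..<2 * k]"

lemma interleave_nth:
  assumes "i < k"
  shows "interleave k m n ! (2 * i) = m ! i" "interleave k m n ! Suc (2 * i) = n ! i"
  using assms by (simp_all add: interleave_def)

lemma strictly_sorted_interleave:
  assumes "interlaced k m n"
  shows "sorted_wrt (<) (interleave k m n)"
proof -
  have "interleave k m n ! i < interleave k m n ! Suc i" if i: "Suc i < 2 * k" for i
  proof (cases "even i")
    case True
    then obtain j where "i = 2 * j" by (elim evenE)
    then show ?thesis using assms i by (simp add: interleave_nth interlaced_def)
  next
    case False
    then obtain j where j: "i = Suc (2 * j)" by (elim oddE) simp
    have "interleave k m n ! Suc i = m ! Suc j"
      using interleave_nth(1)[of "Suc j" k m n] i j by simp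
    then show ?thesis using assms i j by (simp add: interleave_nth interlaced_def)
  qed
  then show ?thesis by (simp add: sorted_wrt_iff_nth_Suc_transp interleave_def)
qed

lemma set_interleave:
  assumes "length m = k" "length n = k"
  shows "set (interleave k m n) = set m \<union> set n"
proof
  show "set (interleave k m n) \<subseteq> set m \<union> set n"
    using assms by (auto simp: interleave_def less_mult_imp_div_less mult.commute)
  have "m ! i \<in> set (interleave k m n)" "n ! i \<in> set (interleave k m n)" if "i < k" for i
  proof -
    have "2 * i < length (interleave k m n)" "Suc (2 * i) < length (interleave k m n)"
      using that by (simp_all add: interleave_def)
    then show "m ! i \<in> set (interleave k m n)" "n ! i \<in> set (interleave k m n)"
      using nth_mem interleave_nth[OF that] by metis+
  qed
  then show "set m \<union> set n \<subseteq> set (interleave k m n)"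
    using assms by (auto simp: in_set_conv_nth[of _ m] in_set_conv_nth[of _ n])
qed

lemma card_interlaced:
  assumes "length m = k" "length n = k" "interlaced k m n"
  shows "card (set m \<union> set n) = 2 * k"
proof -
  have "distinct (interleave k m n)" using strictly_sorted_interleave[OF assms(3)] strict_sorted_iff by blast
  then show ?thesis using distinct_card set_interleave[OF assms(1,2)] by (fastforce simp: interleave_def)
qed

lemma interlaced_unique:
  assumes "length m = k" "length n = k" "interlaced k m n"
    and "length m' = k" "length n' = k" "interlaced k m' n'"
    and "set m \<union> set n = set m' \<union> set n'"
  shows "m = m'" "n = n'"
proof -
  have "interleave k m n = interleave k m' n'"
    using strictly_sorted_interleave[OF assms(3)] strictly_sorted_interleave[OF assms(6)] assms(7)
      set_interleave[OF assms(1,2)] set_interleave[OF assms(4,5)]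
    unfolding strict_sorted_iff by (intro sorted_distinct_set_unique) auto
  then have "m ! i = m' ! i \<and> n ! i = n' ! i" if "i < k" for i
    using interleave_nth[OF that] by metis
  then show "m = m'" "n = n'" using assms(1,2,4,5) by (auto intro: nth_equalityI)
qed

text \<open>Ramsey's theorem for interlaced pairs, coded as sets with \<open>2 * k\<close> elements: a property that some
  pair has in every infinite subset holds for all pairs in a suitable infinite subset.\<close>

lemma ramsey_interlaced:
  assumes ex: "\<And>Y. Y \<subseteq> A \<Longrightarrow> infinite Y \<Longrightarrow>
      \<exists>m n. length m = k \<and> length n = k \<and> set m \<subseteq> Y \<and> set n \<subseteq> Y \<and> interlaced k m n \<and> P m n"
    and A: "infinite A"
  shows "\<exists>Y\<subseteq>A. infinite Y \<and> (\<forall>m n. length m = k \<and> length n = k \<and> set m \<subseteq> Y \<and> set n \<subseteq> Y \<and>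
      interlaced k m n \<longrightarrow> P m n)"
proof -
  define col :: "nat set \<Rightarrow> nat" where "col X = (if \<exists>m n. length m = k \<and> length n = k \<and> interlaced k m n \<and>
      set m \<union> set n = X \<and> \<not> P m n then 1 else 0)" for X
  have "\<forall>X. X \<subseteq> A \<and> finite X \<and> card X = 2 * k \<longrightarrow> col X < 2" by (simp add: col_def)
  from Ramsey[OF A this] obtain Y t where *: "Y \<subseteq> A \<and> infinite Y \<and> t < 2 \<and>
      (\<forall>X. X \<subseteq> Y \<and> finite X \<and> card X = 2 * k \<longrightarrow> col X = t)"
    by (elim exE)
  then have Y: "Y \<subseteq> A" "infinite Y" "\<And>X. X \<subseteq> Y \<Longrightarrow> finite X \<Longrightarrow> card X = 2 * k \<Longrightarrow> col X = t"
    by simp_all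
  have col: "col (set m \<union> set n) = t"
    if "length m = k" "length n = k" "set m \<subseteq> Y" "set n \<subseteq> Y" "interlaced k m n" for m n
    using that card_interlaced by (intro Y(3)) auto
  obtain m n where mn: "length m = k" "length n = k" "set m \<subseteq> Y" "set n \<subseteq> Y" "interlaced k m n" "P m n"
    using ex[OF Y(1,2)] by blast
  have "col (set m \<union> set n) = 0"
    using mn(1,2,5,6) interlaced_unique unfolding col_def by (metis (no_types, lifting))
  then have "t = 0" using col[OF mn(1-5)] by simp
  have "P m n" if "length m = k" "length n = k" "set m \<subseteq> Y" "set n \<subseteq> Y" "interlaced k m n" for m n
  proof (rule ccontr)
    assume "\<not> P m n"
    then have "col (set m \<union> set n) = 1" using that unfolding col_def by auto
    then show False using col[OF that] \<open>t = 0\<close> by simp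
  qed
  then show ?thesis using Y(1,2) by blast
qed


section \<open>Lipschitz maps on Hamming spaces and the main estimate\<close>

lemma dist_le_Lip:
  assumes f: "Lipschitz_continuous_map M1 M2 f" and xy: "x \<in> mspace M1" "y \<in> mspace M1"
  shows "mdist M2 (f x) (f y) \<le> Lip M1 M2 f * mdist M1 x y"
proof (cases "x = y")
  case True
  have "f x \<in> mspace M2" using f xy by (auto simp: Lipschitz_continuous_map_def)
  then have "mdist M2 (f x) (f y) = 0" "mdist M1 x y = 0" using xy True by (simp_all add: mdist_zero)
  then show ?thesis by simp
next
  case False
  let ?S = "{mdist M2 (f x) (f y) / mdist M1 x y | x y. x \<in> mspace M1 \<and> y \<in> mspace M1 \<and> x \<noteq> y}"
  obtain B where B: "\<forall>x\<in>mspace M1. \<forall>y\<in>mspace M1. mdist M2 (f x) (f y) \<le> B * mdist M1 x y"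
    using f unfolding Lipschitz_continuous_map_def by blast
  have pos: "0 < mdist M1 x y" if "x \<in> mspace M1" "y \<in> mspace M1" "x \<noteq> y" for x y
    using that mdist_nonneg[of M1 x y] by (simp add: less_le)
  have "bdd_above ?S"
    by (rule bdd_aboveI[of _ B]) (use B pos in \<open>auto simp: divide_le_eq\<close>)
  then have "mdist M2 (f x) (f y) / mdist M1 x y \<le> Lip M1 M2 f"
    unfolding Lip_def using xy False by (intro cSup_upper) auto
  then show ?thesis using pos[OF xy False] by (simp add: divide_le_eq)
qed

lemma hamming_le: "hamming k x y \<le> k"
proof -
  have "card {i. i < k \<and> x ! i \<noteq> y ! i} \<le> card {..<k}" by (rule card_mono) auto
  then show ?thesis by (simp add: hamming_def)
qed

lemma hamming_one_coordinate:
  assumes "length (a @ x # c) = k" shows "hamming k (a @ x # c) (a @ y # c) \<le> 1"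
proof -
  have "card {i. i < k \<and> (a @ x # c) ! i \<noteq> (a @ y # c) ! i} \<le> card {length a}"
    by (rule card_mono) (auto simp: nth_append nth_Cons')
  then show ?thesis by (simp add: hamming_def)
qed

text \<open>The defining bound multiplied by \<open>k powr (1 / p)\<close>, using \<open>1 / p + 1 / q = 1\<close>.\<close>

lemma class_N0_bound:
  assumes "A \<in> class_N0 p"
  obtains C where "\<And>k. 1 \<le> k \<Longrightarrow> k * theta0 k A \<le> C * real k powr enn2real (1 / p)"
proof -
  obtain q :: ennreal where q: "1 / p + 1 / q = 1" and
    bdd: "bdd_above ((\<lambda>n. theta0 n A * real n powr enn2real (1 / q)) ` {1..})"
    using assms unfolding class_N0_def by blast
  have fin: "1 / p < top" "1 / q < top"
    using q by (metis add_top ennreal_add_eq_top ennreal_one_neq_top top.not_eq_extremum)+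
  have sum1: "enn2real (1 / p) + enn2real (1 / q) = 1"
    using enn2real_plus[OF fin] q by simp
  obtain C where C: "\<And>n. 1 \<le> n \<Longrightarrow> theta0 n A * real n powr enn2real (1 / q) \<le> C"
    using bdd unfolding bdd_above_def by auto
  have "k * theta0 k A \<le> C * real k powr enn2real (1 / p)" if k: "1 \<le> k" for k
  proof -
    have "real k = real k powr enn2real (1 / q) * real k powr enn2real (1 / p)"
      using k sum1 by (simp add: powr_add[symmetric] add.commute)
    then have "k * theta0 k A = (theta0 k A * real k powr enn2real (1 / q)) * real k powr enn2real (1 / p)"
      by (metis mult.assoc mult.commute)
    also have "\<dots> \<le> C * real k powr enn2real (1 / p)" by (intro mult_right_mono C k) simp
    finally show ?thesis .
  qed
  then show ?thesis using that by blast
qed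

theorem theorem1p3:
  fixes p :: ennreal
  assumes "1 < p"
    and "quasi_reflexive TYPE('a::banach)"
    and "(id_blinfun :: 'a \<Rightarrow>\<^sub>L 'a) \<in> class_N0 p"
  shows "\<exists>C::real. \<forall>k\<ge>1. \<forall>f :: nat list \<Rightarrow> 'a.
    Lipschitz_continuous_map (G k) euclidean_metric f \<longrightarrow>
    (\<exists>M \<subseteq> {1..}. infinite M \<and>
      (\<forall>m n. length m = k \<and> length n = k \<and> set m \<subseteq> M \<and> set n \<subseteq> M \<and>
         interlaced k m n \<longrightarrow>
         norm (f m - f n)
           \<le> C * Lip (G k) euclidean_metric f * real k powr enn2real (1 / p)))"
proof -
  obtain C where C: "\<And>k. 1 \<le> k \<Longrightarrow> k * theta0 k (id_blinfun :: 'a \<Rightarrow>\<^sub>L 'a) \<le> C * real k powr enn2real (1 / p)"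
    using class_N0_bound[OF assms(3)] by blast
  show ?thesis
  proof (intro exI[of _ "3 * C + 2"] allI impI)
    fix k :: nat and f :: "nat list \<Rightarrow> 'a"
    assume k: "1 \<le> k" and f: "Lipschitz_continuous_map (G k) euclidean_metric f"
    let ?L = "Lip (G k) euclidean_metric f"
    let ?P = "real k powr enn2real (1 / p)"
    have L: "norm (f x - f y) \<le> ?L * hamming k x y" if "x \<in> G_carrier k" "y \<in> G_carrier k" for x y
      using dist_le_Lip[OF f, of x y] that by (simp add: dist_norm)
    have r: "replicate k 1 \<in> G_carrier k" "replicate k 2 \<in> G_carrier k" by (auto simp: G_carrier_def)
    have "{i. i < k \<and> replicate k (1 :: nat) ! i \<noteq> replicate k 2 ! i} = {..<k}" by auto
    then have "hamming k (replicate k 1) (replicate k 2) = k" by (simp add: hamming_def)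
    then have "0 \<le> ?L * k" using order_trans[OF norm_ge_zero L[OF r]] by simp
    then have L0: "0 \<le> ?L" using k by (simp add: zero_le_mult_iff)
    have P1: "1 \<le> ?P" using k by (simp add: ge_one_powr_ge_zero)
    have pair: "\<exists>m n. length m = k \<and> length n = k \<and> set m \<subseteq> Y \<and> set n \<subseteq> Y \<and> interlaced k m n \<and>
       norm (f m - f n) \<le> (3 * C + 2) * ?L * ?P" if Y: "Y \<subseteq> {1..}" "infinite Y" for Y
    proof -
      \<comment> \<open>The factor \<open>c\<close> normalises \<open>f\<close>; the value \<open>1\<close> avoids a division by \<open>0\<close> when \<open>f\<close> is constant.\<close>
      define c where "c = (if ?L = 0 then 1 else ?L)"
      have c: "0 < c" "?L \<le> c" using L0 by (auto simp: c_def)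
      \<comment> \<open>The normalised function on all lists: entries \<open>0\<close> are read as \<open>1\<close>, lists of other lengths go to \<open>0\<close>.\<close>
      define g where "g s = (if length s = k then (1 / c) *\<^sub>R (f (map (max 1) s) - f (replicate k 1)) else 0)" for s
      have carrier: "map (max 1) s \<in> G_carrier k" if "length s = k" for s
        using that by (auto simp: G_carrier_def)
      have scaled: "norm ((1 / c) *\<^sub>R (f x - f y)) \<le> hamming k x y" if "x \<in> G_carrier k" "y \<in> G_carrier k" for x y
      proof -
        have "norm (f x - f y) \<le> c * hamming k x y"
          using L[OF that] c(2) mult_right_mono[of ?L c "hamming k x y"] by (simp add: hamming_def)
        then show ?thesis using c(1) by (simp add: divide_le_eq mult.commute)
      qed
      have "norm (g s) \<le> k" for s
        using scaled[OF carrier r(1), of s] hamming_le[of k "map (max 1) s" "replicate k 1"]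
        unfolding g_def by fastforce
      moreover have "norm (g (a @ x # d) - g (a @ y # d)) \<le> 1" for a x y d
      proof (cases "length (a @ x # d) = k")
        case True
        then have True': "length (a @ y # d) = k" by simp
        have "g (a @ x # d) - g (a @ y # d) = (1 / c) *\<^sub>R (f (map (max 1) (a @ x # d)) - f (map (max 1) (a @ y # d)))"
          using True by (simp add: g_def algebra_simps)
        also have "norm \<dots> \<le> hamming k (map (max 1) (a @ x # d)) (map (max 1) (a @ y # d))"
          by (rule scaled[OF carrier[OF True] carrier[OF True']])
        also have "\<dots> \<le> 1"
          using hamming_one_coordinate[of "map (max 1) a" _ "map (max 1) d"] True by simp
        finally show ?thesis .
      next
        case False
        then show ?thesis by (simp add: g_def)
      qed
      ultimately obtain m n where mn: "length m = k" "length n = k" "set m \<subseteq> Y" "set n \<subseteq> Y" "interlaced k m n"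
        "norm (g m - g n) \<le> 3 * (k * theta0 k (id_blinfun :: 'a \<Rightarrow>\<^sub>L 'a)) + 2"
        using exists_interlaced_pair[OF assms(2) k Y(2)] by blast
      have id: "map (max 1) s = s" if "set s \<subseteq> Y" for s
        using that Y(1) by (intro map_idI) (auto simp: max_def)
      have G: "m \<in> G_carrier k" "n \<in> G_carrier k" using mn Y(1) by (auto simp: G_carrier_def)
      have "norm (f m - f n) \<le> (3 * C + 2) * ?L * ?P"
      proof (cases "?L = 0")
        case True
        then show ?thesis using L[OF G] by simp
      next
        case False
        have "g m - g n = (1 / ?L) *\<^sub>R (f m - f n)"
          using False mn(1,2) id[OF mn(3)] id[OF mn(4)] by (simp add: g_def c_def algebra_simps)
        then have "norm (f m - f n) / ?L \<le> 3 * (C * ?P) + 2" using mn(6) C[OF k] L0 by simp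
        also have "\<dots> \<le> (3 * C + 2) * ?P" using P1 by (simp add: algebra_simps)
        finally show ?thesis using False L0 by (simp add: divide_le_eq mult_ac)
      qed
      then show ?thesis using mn(1-5) by blast
    qed
    show "\<exists>M\<subseteq>{1..}. infinite M \<and> (\<forall>m n. length m = k \<and> length n = k \<and> set m \<subseteq> M \<and> set n \<subseteq> M \<and>
         interlaced k m n \<longrightarrow> norm (f m - f n) \<le> (3 * C + 2) * ?L * ?P)"
      using ramsey_interlaced[OF pair] by (simp add: infinite_Ici)
  qed
qed

end
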